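(* Let $m$ be a positive even integer satisfying $m\equiv 1\pmod 3$, $\nu_2(m(m+1))\leq 5$, and $\nu_p(m(m+1))\leq 1$ for every prime $p\geq 7$ with $p\equiv 3\pmod 4$. Then there is no tight spherical $5$-design in dimension $n=(2m+1)^2-2$.
   Context: For a prime $p$ and a positive integer $a$, $\nu_p(a)$ denotes the exponent of $p$ in the prime factorization of $a$. A spherical $t$-design in dimension $n$ is a finite nonempty subset $D$ of the unit sphere $\mathbb{S}^{n-1}\subset\mathbb{R}^n$ such that $\frac{1}{|D|}\sum_{x\in D}f(x)=\int_{\mathbb{S}^{n-1}}f\,d\sigma$ for every real polynomial $f$ in $n$ variables of total degree at most $t$, where $\sigma$ is the surface measure normalized to total mass $1$. Every spherical $5$-design in dimension $n$ satisfies $|D|\geq 2\binom{n+1}{2}=n(n+1)$ (Delsarte, Goethals, Seidel); a spherical $5$-design is called tight if $|D|=n(n+1)$. *)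

theory Defs
  imports
    "HOL-Analysis.Analysis"
    "HOL-Computational_Algebra.Primes"
    "HOL-Number_Theory.Cong"
begin

text \<open>
  The normalized surface measure on the unit sphere, obtained from Lebesgue measure by polar
  coordinates: the surface measure of a Borel set \<open>A\<close> of unit vectors is \<open>n\<close> times the volume of
  the solid cone \<open>{r *\<^sub>R u | 0 < r < 1, u \<in> A}\<close>, and the total surface measure is \<open>n\<close> times the
  volume of the unit ball (see \<open>emeasure_sphere_measure_cone\<close>).  Note that
  \<open>sgn x = x /\<^sub>R norm x\<close> in a normed space.  The measure lives on the Borel sets of the ambient
  space and is carried by the sphere (see \<open>emeasure_sphere_measure_sphere\<close>).
\<close>

definition sphere_measure :: "'a::euclidean_space measure" where
  "sphere_measure = distr (uniform_measure lborel (ball 0 1)) borel sgn"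

text \<open>
  Real polynomial functions of total degree at most \<open>t\<close> in the coordinates of \<open>real ^ 'n\<close>;
  the monomials are indexed by their exponent vectors \<open>\<alpha>\<close>.  The index set is finite, so the
  sum is a genuine one (see \<open>finite_exponents\<close>).
\<close>

definition polynomial_of_degree_le :: "nat \<Rightarrow> (real ^ 'n::finite \<Rightarrow> real) \<Rightarrow> bool" where
  "polynomial_of_degree_le t f \<longleftrightarrow>
     (\<exists>c :: ('n \<Rightarrow> nat) \<Rightarrow> real.
        \<forall>x. f x = (\<Sum>\<alpha> | (\<Sum>i\<in>UNIV. \<alpha> i) \<le> t. c \<alpha> * (\<Prod>i\<in>UNIV. (x $ i) ^ \<alpha> i)))"

definition spherical_design :: "nat \<Rightarrow> (real ^ 'n::finite) set \<Rightarrow> bool" where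
  "spherical_design t D \<longleftrightarrow>
     finite D \<and> D \<noteq> {} \<and> D \<subseteq> sphere 0 1 \<and>
     (\<forall>f. polynomial_of_degree_le t f \<longrightarrow>
        (\<Sum>x\<in>D. f x) / real (card D) = (LINT x:sphere 0 1|sphere_measure. f x))"

definition tight_spherical_5_design :: "(real ^ 'n::finite) set \<Rightarrow> bool" where
  "tight_spherical_5_design D \<longleftrightarrow>
     spherical_design 5 D \<and> card D = CARD('n) * (CARD('n) + 1)"


lemma finite_exponents: "finite {\<alpha> :: 'n::finite \<Rightarrow> nat. (\<Sum>i\<in>UNIV. \<alpha> i) \<le> t}"
proof (rule finite_subset)
  show "{\<alpha> :: 'n \<Rightarrow> nat. (\<Sum>i\<in>UNIV. \<alpha> i) \<le> t} \<subseteq> PiE UNIV (\<lambda>_. {..t})"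
  proof
    fix \<alpha> :: "'n \<Rightarrow> nat" assume "\<alpha> \<in> {\<alpha>. (\<Sum>i\<in>UNIV. \<alpha> i) \<le> t}"
    then have "\<alpha> i \<le> t" for i
      using member_le_sum[of i UNIV \<alpha>] by simp
    then show "\<alpha> \<in> PiE UNIV (\<lambda>_. {..t})" by (auto simp: PiE_def)
  qed
  show "finite (PiE (UNIV :: 'n set) (\<lambda>_. {..t}))"
    by (intro finite_PiE) simp_all
qed

lemma measurable_sgn [measurable]:
  "(sgn :: 'a::euclidean_space \<Rightarrow> 'a) \<in> borel_measurable borel"
  unfolding sgn_div_norm by measurable

lemma emeasure_sphere_measure:
  fixes A :: "'a::euclidean_space set"
  assumes "A \<in> sets borel"
  shows "emeasure sphere_measure A =
    emeasure lborel {x \<in> ball 0 1. sgn x \<in> A} / emeasure lborel (ball (0::'a) 1)"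
proof -
  have [measurable]: "sgn -` A \<in> sets (borel :: 'a measure)"
    using measurable_sets[OF measurable_sgn assms] by simp
  have "ball 0 1 \<inter> sgn -` A = {x \<in> ball 0 1. sgn x \<in> A}"
    by auto
  with assms show ?thesis
    by (simp add: sphere_measure_def emeasure_distr)
qed

lemma emeasure_sphere_measure_cone:
  fixes A :: "'a::euclidean_space set"
  assumes "A \<in> sets borel" "A \<subseteq> sphere 0 1"
  shows "emeasure sphere_measure A =
    emeasure lborel {r *\<^sub>R u | r u. 0 < r \<and> r < 1 \<and> u \<in> A} / emeasure lborel (ball (0::'a) 1)"
proof -
  have "{x \<in> ball 0 1. sgn x \<in> A} = {r *\<^sub>R u | r u. 0 < r \<and> r < 1 \<and> u \<in> A}" (is "?L = ?R")
  proof (intro set_eqI iffI)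
    fix x assume x: "x \<in> ?L"
    then have "x \<noteq> 0" using assms(2) by auto
    with x have "0 < norm x \<and> norm x < 1 \<and> sgn x \<in> A \<and> x = norm x *\<^sub>R sgn x"
      by (simp add: sgn_div_norm)
    then show "x \<in> ?R" by blast
  next
    fix x assume "x \<in> ?R"
    then obtain r u where *: "x = r *\<^sub>R u" "0 < r" "r < 1" "u \<in> A" by blast
    with assms(2) have "norm u = 1" by auto
    with * show "x \<in> ?L" by (simp add: sgn_div_norm)
  qed
  with emeasure_sphere_measure[OF assms(1)] show ?thesis by simp
qed

lemma emeasure_sphere_measure_sphere:
  "emeasure sphere_measure (sphere (0::'a::euclidean_space) 1) = 1"
  "emeasure sphere_measure (UNIV :: 'a set) = 1"
proof -
  let ?B = "ball (0::'a) 1"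
  have pos: "emeasure lborel ?B \<noteq> 0"
    using content_ball_pos[of 1 "0::'a"] by (auto simp: measure_def)
  have fin: "emeasure lborel ?B \<noteq> \<infinity>"
    using emeasure_lborel_ball_finite[of "0::'a" 1] by simp
  have "{x \<in> ?B. sgn x \<in> sphere 0 1} = ?B - {0}"
    by (auto simp: norm_sgn)
  moreover have "emeasure lborel (?B - {0}) = emeasure lborel ?B"
    by (rule emeasure_Diff_null_set) auto
  ultimately show "emeasure sphere_measure (sphere (0::'a) 1) = 1"
    using pos fin by (simp add: emeasure_sphere_measure less_top)
  show "emeasure sphere_measure (UNIV :: 'a set) = 1"
    using pos fin by (simp add: emeasure_sphere_measure less_top del: mem_ball mem_ball_0)
qed

end

theory Submission
  imports Defs
begin

text \<open>
  Put \<open>d = 2 m + 1\<close> and \<open>n = d\<^sup>2 - 2\<close>.  A tight 5-design \<open>Z\<close>, rescaled to norm \<open>d\<close>,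
  has inner products \<open>\<plusminus>d, \<plusminus>1\<close>.  The design identities of degree 2 and 4 turn divisibility of
  \<open>t\<^sup>2 (t\<^sup>2 - 1)\<close> and, for odd \<open>t\<close>, of \<open>(t\<^sup>2 - 1) (t\<^sup>2 - 9)\<close> into conditions on the norms of vectors in the
  dual of the lattice \<open>L\<close> generated by \<open>Z\<close>.  At a prime \<open>p \<equiv> 3 (mod 4)\<close> they force \<open>L\<close> to be
  unimodular, so the Gram determinant \<open>g > 0\<close> of a basis of \<open>\<real>\<^sup>n\<close> taken from \<open>Z\<close> has even valuation at
  \<open>p\<close>; hence the odd part of \<open>g\<close> is \<open>1 (mod 4)\<close>.  At 2 all inner products in \<open>Z\<close> are odd, so that
  splitting off one vector leaves \<open>2 K\<close> with \<open>K\<close> even of rank \<open>n - 1 \<equiv> 2 (mod 4)\<close>, and the dual norm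
  conditions make \<open>2 K\<^sup>-\<^sup>1\<close> even too.  Then \<open>K\<close> is an orthogonal sum of even unimodular planes, each of
  determinant \<open>-1 (mod 4)\<close>, scaled by 1 or 2, and the odd part of \<open>g\<close> is \<open>3 (mod 4)\<close>: a contradiction.
\<close>

section \<open>Moments of the surface measure\<close>

text \<open>The lattice is never built as an object. Gram determinants of two bases taken from
  \<open>Z\<close> differ by the square of a rational number, so the parity of a valuation can be
  read off at each prime from a basis adapted to that prime, and a dual vector at \<open>p\<close>
  is simply a vector whose inner products with all of \<open>Z\<close> are
  \<open>p\<close>-integral. The hypotheses on \<open>m\<close> all enter through
  \<open>M = m * (m + 1)\<close>, because \<open>n + 1 = 4 * M\<close> is a common factor of the
  moments of degree 0, 2 and 4. A denominator divisible by \<open>p\<close> in the norm of a dual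
  vector would have to be absorbed by \<open>M\<close>: this needs \<open>p\<^sup>2\<close> to
  divide \<open>M\<close> for \<open>p \<ge> 5\<close>, and 64 to divide \<open>M\<close> at 2,
  since the odd quartic leaves the divisor \<open>192 = 3 * 64\<close>. At 3 the condition
  \<open>m = 1\<close> modulo 3 makes 3 divide \<open>d\<close> but not \<open>M\<close>. Primes
  that are 1 modulo 4 impose nothing, as they cannot change a residue modulo 4. Positivity of
  \<open>g\<close> is essential: -1 is also 3 modulo 4 but has no prime factor.\<close>

lemma lborel_distr_shear:
  fixes b :: "'a::euclidean_space"
  assumes b: "b \<in> Basis" and g [measurable]: "g \<in> borel_measurable borel"
    and inv: "\<And>x c. g (x + c *\<^sub>R b) = g x"
  shows "distr lborel borel (\<lambda>x. x + g x *\<^sub>R b) = lborel"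
proof (rule measure_eqI)
  fix A assume "A \<in> sets (distr lborel borel (\<lambda>x. x + g x *\<^sub>R b))"
  then have A [measurable]: "A \<in> sets borel" by simp
  interpret P: product_sigma_finite "\<lambda>_::'a. lborel :: real measure" ..
  define I where "I = Basis - {b}"
  have I: "Basis = insert b I" "finite I" "b \<notin> I"
    using b by (auto simp: I_def)
  define s where "s f = (\<Sum>i\<in>Basis. f i *\<^sub>R i)" for f :: "'a \<Rightarrow> real"
  have s [measurable]: "s \<in> borel_measurable (Pi\<^sub>M Basis (\<lambda>_. lborel))"
    unfolding s_def by measurable
  have s_upd: "s (f(b := y)) = s (f(b := 0)) + y *\<^sub>R b" for f y
  proof -
    have "(\<Sum>i\<in>I. (f(b := y)) i *\<^sub>R i) = (\<Sum>i\<in>I. (f(b := 0)) i *\<^sub>R i)"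
      using I by (intro sum.cong) auto
    then show ?thesis
      using I unfolding s_def I(1) by (simp add: algebra_simps)
  qed
  \<comment> \<open>Fubini with the coordinate along \<open>b\<close> innermost. By
    \<open>inv\<close>, \<open>g\<close> does not depend on that coordinate, so on each line the
    shear is a translation by a constant.\<close>
  have fub: "(\<integral>\<^sup>+x. h x \<partial>lborel) =
      (\<integral>\<^sup>+f. \<integral>\<^sup>+y. h (s (f(b := 0)) + y *\<^sub>R b) \<partial>lborel \<partial>Pi\<^sub>M I (\<lambda>_. lborel))"
    if [measurable]: "h \<in> borel_measurable borel" for h :: "'a \<Rightarrow> ennreal"
  proof -
    have "(\<integral>\<^sup>+x. h x \<partial>lborel) = (\<integral>\<^sup>+f. h (s f) \<partial>Pi\<^sub>M Basis (\<lambda>_. lborel))"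
      unfolding s_def by (subst lborel_eq, subst nn_integral_distr) auto
    also have "\<dots> = (\<integral>\<^sup>+f. \<integral>\<^sup>+y. h (s (f(b := y))) \<partial>lborel \<partial>Pi\<^sub>M I (\<lambda>_. lborel))"
      unfolding I(1)
      by (rule P.product_nn_integral_insert) (use I in \<open>auto simp: I(1)[symmetric]\<close>)
    finally show ?thesis by (subst (asm) s_upd)
  qed
  have "emeasure (distr lborel borel (\<lambda>x. x + g x *\<^sub>R b)) A
      = (\<integral>\<^sup>+x. indicator A (x + g x *\<^sub>R b) \<partial>lborel)"
  proof -
    have "emeasure (distr lborel borel (\<lambda>x. x + g x *\<^sub>R b)) A
      = (\<integral>\<^sup>+x. indicator A x \<partial>distr lborel borel (\<lambda>x. x + g x *\<^sub>R b))"
      by simp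
    also have "\<dots> = (\<integral>\<^sup>+x. indicator A (x + g x *\<^sub>R b) \<partial>lborel)"
      by (rule nn_integral_distr) auto
    finally show ?thesis .
  qed
  also have "\<dots> = (\<integral>\<^sup>+f. \<integral>\<^sup>+y. indicator A (s (f(b := 0)) + y *\<^sub>R b +
      g (s (f(b := 0))) *\<^sub>R b) \<partial>lborel \<partial>Pi\<^sub>M I (\<lambda>_. lborel))"
    by (subst fub) (auto simp: inv)
  also have "\<dots> = (\<integral>\<^sup>+f. \<integral>\<^sup>+y. indicator A (s (f(b := 0)) + y *\<^sub>R b)
      \<partial>lborel \<partial>Pi\<^sub>M I (\<lambda>_. lborel))"
  proof (rule nn_integral_cong)
    fix f
    define v t where "v = s (f(b := 0))" and "t = g (s (f(b := 0)))"
    have "(\<integral>\<^sup>+y. indicator A (v + y *\<^sub>R b) \<partial>lborel) =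
        (\<integral>\<^sup>+y. indicator A (v + (t + y) *\<^sub>R b) \<partial>lborel)"
      by (subst nn_integral_real_affine[where c = 1 and t = t]) auto
    then show "(\<integral>\<^sup>+y. indicator A (v + y *\<^sub>R b + t *\<^sub>R b) \<partial>lborel) =
        (\<integral>\<^sup>+y. indicator A (v + y *\<^sub>R b) \<partial>lborel)"
      by (simp add: algebra_simps)
  qed
  also have "\<dots> = emeasure lborel A"
    by (subst fub[symmetric]) auto
  finally show "emeasure (distr lborel borel (\<lambda>x. x + g x *\<^sub>R b)) A = emeasure lborel A" .
qed simp

section \<open>Rotation invariance of the surface measure\<close>

text \<open>Written as the identity plus a correction in the plane of \<open>b\<close> and
  \<open>b'\<close>, so that linearity and measurability need no change of coordinates. For
  \<open>c\<^sup>2 + s\<^sup>2 = 1\<close>, \<open>c\<close> and \<open>s\<close> are the cosine and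
  sine of the angle.\<close>

definition plane_rotation :: "'a::euclidean_space \<Rightarrow> 'a \<Rightarrow> real \<Rightarrow> real \<Rightarrow> 'a \<Rightarrow> 'a" where
  "plane_rotation b b' c s x =
     x + ((c - 1) * (x \<bullet> b) - s * (x \<bullet> b')) *\<^sub>R b + (s * (x \<bullet> b) + (c - 1) * (x \<bullet> b')) *\<^sub>R b'"

lemma linear_plane_rotation: "linear (plane_rotation b b' c s)"
  unfolding plane_rotation_def
  by (rule linearI) (simp_all add: inner_add_left algebra_simps)

lemma measurable_plane_rotation [measurable]: "plane_rotation b b' c s \<in> borel_measurable borel"
  unfolding plane_rotation_def by measurable

lemma norm_plane_rotation:
  assumes b: "b \<in> Basis" "b' \<in> Basis" "b \<noteq> b'" and cs: "c\<^sup>2 + s\<^sup>2 = 1"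
  shows "norm (plane_rotation b b' c s x) = norm x"
proof -
  have bb: "b \<bullet> b = 1" "b' \<bullet> b' = 1" "b \<bullet> b' = 0" "b' \<bullet> b = 0"
    using b by (auto simp: inner_Basis)
  have "plane_rotation b b' c s x \<bullet> plane_rotation b b' c s x =
      x \<bullet> x + (c\<^sup>2 + s\<^sup>2 - 1) * ((x \<bullet> b)\<^sup>2 + (x \<bullet> b')\<^sup>2)"
    by (simp add: plane_rotation_def inner_add_left inner_add_right bb inner_commute[of b x]
        inner_commute[of b' x] power2_eq_square algebra_simps)
  then show ?thesis
    using cs by (simp add: norm_eq_sqrt_inner)
qed

text \<open>A rotation by an angle that is not a multiple of \<open>\<pi>\<close> is a product of three shears.\<close>

lemma lborel_distr_plane_rotation:
  fixes b b' :: "'a::euclidean_space"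
  assumes b: "b \<in> Basis" "b' \<in> Basis" "b \<noteq> b'" and cs: "c\<^sup>2 + s\<^sup>2 = 1" "s \<noteq> 0"
  shows "distr lborel borel (plane_rotation b b' c s) = lborel"
proof -
  have bb: "b \<bullet> b = 1" "b' \<bullet> b' = 1" "b \<bullet> b' = 0" "b' \<bullet> b = 0"
    using b by (auto simp: inner_Basis)
  \<comment> \<open>This is minus the tangent of half the angle, the factor of the two outer shears;
    the division is why \<open>s \<noteq> 0\<close> is required.\<close>
  define t where "t = (c - 1) / s"
  define A where "A x = x + (t * (x \<bullet> b')) *\<^sub>R b" for x :: 'a
  define B where "B x = x + (s * (x \<bullet> b)) *\<^sub>R b'" for x :: 'a
  have [measurable]: "A \<in> borel_measurable borel" "B \<in> borel_measurable borel"
    unfolding A_def B_def by measurable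
  have A: "distr lborel borel A = lborel"
    unfolding A_def by (rule lborel_distr_shear) (use b bb in \<open>auto simp: inner_add_left\<close>)
  have B: "distr lborel borel B = lborel"
    unfolding B_def by (rule lborel_distr_shear) (use b bb in \<open>auto simp: inner_add_left\<close>)
  have st: "s * t = c - 1"
    using cs by (simp add: t_def)
  have "s * (t * (s * t) + 2 * t + s) = (c - 1)\<^sup>2 + 2 * (c - 1) + s\<^sup>2"
    by (simp add: st[symmetric] power2_eq_square algebra_simps)
  also have "\<dots> = 0"
    using cs by (simp add: power2_eq_square algebra_simps)
  finally have tst: "t * (s * t) + t + t = - s"
    using cs by (simp add: add_eq_0_iff)
  have "plane_rotation b b' c s x = A (B (A x))" for x
  proof -
    define p q where "p = x \<bullet> b" and "q = x \<bullet> b'"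
    have "A (B (A x)) = x + (t * q + t * (q + s * (p + t * q))) *\<^sub>R b + (s * (p + t * q)) *\<^sub>R b'"
      by (simp add: A_def B_def inner_add_left bb p_def q_def scaleR_add_left)
    also have "t * q + t * (q + s * (p + t * q)) = (s * t) * p + (t * (s * t) + t + t) * q"
      by (simp add: algebra_simps)
    also have "s * (p + t * q) = s * p + (s * t) * q"
      by (simp add: algebra_simps)
    finally show ?thesis
      unfolding tst unfolding st by (simp add: plane_rotation_def p_def q_def)
  qed
  then have "plane_rotation b b' c s = A \<circ> (B \<circ> A)"
    by (auto simp: fun_eq_iff)
  moreover have "distr lborel borel (A \<circ> (B \<circ> A)) = distr (distr (distr lborel borel A) borel B) borel A"
    by (subst distr_distr, simp, simp, subst distr_distr) (simp_all add: comp_assoc)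
  ultimately show ?thesis
    using A B by simp
qed

text \<open>A linear isometry commutes with \<open>sgn\<close> and maps the ball to itself, so
  invariance passes from Lebesgue measure to the uniform measure on the ball and then to its image
  under \<open>sgn\<close>.\<close>

lemma sphere_measure_distr_plane_rotation:
  fixes b b' :: "'a::euclidean_space"
  assumes b: "b \<in> Basis" "b' \<in> Basis" "b \<noteq> b'" and cs: "c\<^sup>2 + s\<^sup>2 = 1" "s \<noteq> 0"
  shows "distr sphere_measure borel (plane_rotation b b' c s) = sphere_measure"
proof -
  let ?R = "plane_rotation b b' c s"
  note norm = norm_plane_rotation[OF b cs(1)]
  have sgn: "sgn (?R x) = ?R (sgn x)" for x
    using norm[of x] linear_scale[OF linear_plane_rotation[of b b' c s]] by (simp add: sgn_div_norm)
  have U: "distr (uniform_measure lborel (ball 0 1)) borel ?R = uniform_measure lborel (ball 0 1)"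
  proof (rule measure_eqI)
    fix A assume "A \<in> sets (distr (uniform_measure lborel (ball 0 1)) borel ?R)"
    then have A [measurable]: "A \<in> sets borel" by simp
    have "?R -` A \<in> sets borel"
      using measurable_sets[OF measurable_plane_rotation A] by simp
    moreover have "ball 0 1 \<inter> ?R -` A = ?R -` (ball 0 1 \<inter> A) \<inter> space lborel"
      by (auto simp: norm)
    moreover have "emeasure lborel (?R -` (ball 0 1 \<inter> A) \<inter> space lborel) =
        emeasure (distr lborel borel ?R) (ball 0 1 \<inter> A)"
      by (subst emeasure_distr) auto
    ultimately show "emeasure (distr (uniform_measure lborel (ball 0 1)) borel ?R) A =
        emeasure (uniform_measure lborel (ball 0 1)) A"
      by (simp add: emeasure_distr lborel_distr_plane_rotation[OF b cs])
  qed simp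
  have "distr sphere_measure borel ?R = distr (uniform_measure lborel (ball 0 1)) borel (?R \<circ> sgn)"
    unfolding sphere_measure_def by (rule distr_distr) auto
  also have "?R \<circ> sgn = sgn \<circ> ?R"
    by (simp add: fun_eq_iff sgn)
  also have "distr (uniform_measure lborel (ball 0 1)) borel (sgn \<circ> ?R) =
      distr (distr (uniform_measure lborel (ball 0 1)) borel ?R) borel sgn"
    by (rule distr_distr[symmetric]) auto
  finally show ?thesis
    by (simp add: U sphere_measure_def)
qed

section \<open>Averages of functions of a single inner product\<close>

abbreviation sphere_mean :: "('a::euclidean_space \<Rightarrow> real) \<Rightarrow> real" where
  "sphere_mean f \<equiv> LINT x:sphere 0 1|sphere_measure. f x"

lemma sets_sphere_measure [measurable_cong, simp]: "sets sphere_measure = sets borel"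
  by (simp add: sphere_measure_def)

lemma sphere_mean_plane_rotation:
  fixes b b' :: "'a::euclidean_space"
  assumes b: "b \<in> Basis" "b' \<in> Basis" "b \<noteq> b'" and cs: "c\<^sup>2 + s\<^sup>2 = 1" "s \<noteq> 0"
    and f [measurable]: "f \<in> borel_measurable borel"
  shows "sphere_mean (\<lambda>x. f (plane_rotation b b' c s x)) = sphere_mean f"
proof -
  let ?R = "plane_rotation b b' c s"
  have [measurable]: "sphere (0::'a) 1 \<in> sets borel"
    by (intro borel_closed closed_sphere)
  have "sphere_mean f = (LINT x|distr sphere_measure borel ?R. indicator (sphere 0 1) x *\<^sub>R f x)"
    by (simp add: sphere_measure_distr_plane_rotation[OF b cs] set_lebesgue_integral_def)
  also have "\<dots> = (LINT x|sphere_measure. indicator (sphere 0 1) (?R x) *\<^sub>R f (?R x))"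
    by (rule integral_distr) (auto simp del: mem_sphere mem_sphere_0)
  also have "\<dots> = sphere_mean (\<lambda>x. f (?R x))"
    by (simp add: set_lebesgue_integral_def indicator_def norm_plane_rotation[OF b cs(1)])
  finally show ?thesis ..
qed

lemma set_integrable_sphere:
  fixes f :: "'a::euclidean_space \<Rightarrow> real"
  assumes "continuous_on UNIV f"
  shows "set_integrable sphere_measure (sphere 0 1) f"
proof -
  have [measurable]: "f \<in> borel_measurable borel"
    using assms by (rule borel_measurable_continuous_onI)
  have [measurable]: "sphere (0::'a) 1 \<in> sets borel"
    by (intro borel_closed closed_sphere)
  have "compact (f ` sphere 0 1)"
    by (rule compact_continuous_image) (use assms continuous_on_subset in auto)
  then obtain B where B: "\<And>x. x \<in> sphere 0 1 \<Longrightarrow> norm (f x) \<le> B"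
    by (meson bounded_iff compact_imp_bounded imageI)
  have "integrable sphere_measure (\<lambda>x. indicator (sphere 0 1) x *\<^sub>R f x)"
  proof (rule finite_measure.integrable_const_bound[where B = "max B 0"])
    show "finite_measure (sphere_measure :: 'a measure)"
      using emeasure_sphere_measure_sphere(2)[where 'a = 'a]
      by (intro finite_measureI) (simp add: sphere_measure_def)
    show "(\<lambda>x. indicator (sphere 0 1) x *\<^sub>R f x) \<in> borel_measurable sphere_measure"
      by measurable
    show "AE x in sphere_measure. norm (indicator (sphere 0 1) x *\<^sub>R f x) \<le> max B 0"
      using B by (intro AE_I2) (auto simp: indicator_def le_max_iff_disj)
  qed
  then show ?thesis
    by (simp add: set_integrable_def)
qed

lemma sphere_mean_const: "sphere_mean (\<lambda>x :: 'a::euclidean_space. c) = c"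
proof -
  have "measure sphere_measure (sphere (0::'a) 1) = 1"
    using emeasure_sphere_measure_sphere(1)[where 'a = 'a] by (simp add: measure_def)
  then show ?thesis
    using emeasure_sphere_measure_sphere(1)[where 'a = 'a]
    by (subst set_integral_const) auto
qed

lemma sphere_mean_cong: "(\<And>x. norm x = 1 \<Longrightarrow> f x = g x) \<Longrightarrow> sphere_mean f = sphere_mean g"
  unfolding set_lebesgue_integral_def by (rule Bochner_Integration.integral_cong) (auto simp: indicator_def)

text \<open>The rotation is chosen to turn the component of \<open>a\<close> in the plane of
  \<open>b\<close> and \<open>b'\<close> onto the positive \<open>b\<close> axis: one coordinate of
  \<open>a\<close> disappears and the norm is kept.\<close>

lemma sphere_mean_inner_merge:
  fixes b b' :: "'a::euclidean_space"
  assumes b: "b \<in> Basis" "b' \<in> Basis" "b \<noteq> b'" and a: "a \<bullet> b' \<noteq> 0"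
    and f [measurable]: "f \<in> borel_measurable borel"
  shows "sphere_mean (\<lambda>x. f (x \<bullet> a)) =
    sphere_mean (\<lambda>x. f (x \<bullet> (a + (sqrt ((a \<bullet> b)\<^sup>2 + (a \<bullet> b')\<^sup>2) - a \<bullet> b) *\<^sub>R b - (a \<bullet> b') *\<^sub>R b')))"
proof -
  define \<rho> where "\<rho> = sqrt ((a \<bullet> b)\<^sup>2 + (a \<bullet> b')\<^sup>2)"
  have \<rho>: "\<rho> > 0" "\<rho>\<^sup>2 = (a \<bullet> b)\<^sup>2 + (a \<bullet> b')\<^sup>2"
    using a by (auto simp: \<rho>_def sum_power2_gt_zero_iff)
  define c s where "c = (a \<bullet> b) / \<rho>" and "s = (a \<bullet> b') / \<rho>"
  have cs: "c\<^sup>2 + s\<^sup>2 = 1" "s \<noteq> 0"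
    using \<rho> a by (simp_all add: c_def s_def power_divide add_divide_distrib[symmetric])
  have ab: "a \<bullet> b = \<rho> * c" "a \<bullet> b' = \<rho> * s"
    using \<rho> by (auto simp: c_def s_def)
  have "plane_rotation b b' c s x \<bullet> a = x \<bullet> (a + (\<rho> - a \<bullet> b) *\<^sub>R b - (a \<bullet> b') *\<^sub>R b')" for x
  proof -
    have "plane_rotation b b' c s x \<bullet> a =
        x \<bullet> a + \<rho> * (x \<bullet> b) * ((c\<^sup>2 + s\<^sup>2) - c) - \<rho> * s * (x \<bullet> b')"
      unfolding plane_rotation_def
      by (simp add: inner_add_left inner_commute[of b a] inner_commute[of b' a] ab
          power2_eq_square algebra_simps)
    then show ?thesis
      by (simp add: cs ab inner_add_right inner_diff_right algebra_simps)
  qed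
  moreover have "sphere_mean (\<lambda>x. f (plane_rotation b b' c s x \<bullet> a)) = sphere_mean (\<lambda>x. f (x \<bullet> a))"
    by (rule sphere_mean_plane_rotation[OF b cs]) auto
  ultimately show ?thesis
    by (simp add: \<rho>_def)
qed

text \<open>Rotation invariance in usable form: the average depends on \<open>a\<close> only through
  its norm. Merging coordinates into \<open>b\<close> one at a time lowers the number of nonzero
  coordinates off \<open>b\<close>.\<close>

lemma sphere_mean_inner:
  fixes a b :: "'a::euclidean_space"
  assumes b: "b \<in> Basis" and dim: "DIM('a) \<ge> 2"
    and f [measurable]: "f \<in> borel_measurable borel"
  shows "sphere_mean (\<lambda>x. f (x \<bullet> a)) = sphere_mean (\<lambda>x. f (norm a * (x \<bullet> b)))"
proof (induction "card {i \<in> Basis - {b}. a \<bullet> i \<noteq> 0}" arbitrary: a rule: less_induct)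
  case less
  show ?case
  proof (cases "\<exists>i \<in> Basis - {b}. a \<bullet> i \<noteq> 0")
    case True
    then obtain i where i: "i \<in> Basis" "b \<noteq> i" "a \<bullet> i \<noteq> 0" by auto
    define a' where "a' = a + (sqrt ((a \<bullet> b)\<^sup>2 + (a \<bullet> i)\<^sup>2) - a \<bullet> b) *\<^sub>R b - (a \<bullet> i) *\<^sub>R i"
    have bi: "b \<bullet> b = 1" "i \<bullet> i = 1" "b \<bullet> i = 0" "i \<bullet> b = 0"
      using b i by (auto simp: inner_Basis)
    have a': "a' \<bullet> j = (if j = b then sqrt ((a \<bullet> b)\<^sup>2 + (a \<bullet> i)\<^sup>2) else if j = i then 0 else a \<bullet> j)"
      if "j \<in> Basis" for j
      using that b i bi by (auto simp: a'_def inner_add_left inner_diff_left inner_Basis)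
    have "{j \<in> Basis - {b}. a' \<bullet> j \<noteq> 0} \<subset> {j \<in> Basis - {b}. a \<bullet> j \<noteq> 0}"
    proof
      show "{j \<in> Basis - {b}. a' \<bullet> j \<noteq> 0} \<subseteq> {j \<in> Basis - {b}. a \<bullet> j \<noteq> 0}"
        by (intro Collect_mono impI) (metis DiffD1 DiffD2 a' singletonI)
      show "{j \<in> Basis - {b}. a' \<bullet> j \<noteq> 0} \<noteq> {j \<in> Basis - {b}. a \<bullet> j \<noteq> 0}"
        using i a'[OF i(1)] by (metis (mono_tags, lifting) DiffI mem_Collect_eq singletonD)
    qed
    then have "card {j \<in> Basis - {b}. a' \<bullet> j \<noteq> 0} < card {j \<in> Basis - {b}. a \<bullet> j \<noteq> 0}"
      by (intro psubset_card_mono) auto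
    then have "sphere_mean (\<lambda>x. f (x \<bullet> a')) = sphere_mean (\<lambda>x. f (norm a' * (x \<bullet> b)))"
      by (rule less)
    moreover have "norm a' = norm a"
    proof -
      have "a' \<bullet> a' = a \<bullet> a"
      proof -
        define r where "r = sqrt ((a \<bullet> b)\<^sup>2 + (a \<bullet> i)\<^sup>2)"
        have "r\<^sup>2 = (a \<bullet> b)\<^sup>2 + (a \<bullet> i)\<^sup>2" by (simp add: r_def)
        then show ?thesis
          unfolding a'_def r_def[symmetric]
          by (simp add: inner_add_left inner_diff_left inner_add_right inner_diff_right bi
              inner_commute[of b a] inner_commute[of i a] power2_eq_square algebra_simps)
      qed
      then show ?thesis by (simp add: norm_eq_sqrt_inner)
    qed
    moreover have "sphere_mean (\<lambda>x. f (x \<bullet> a)) = sphere_mean (\<lambda>x. f (x \<bullet> a'))"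
      unfolding a'_def by (rule sphere_mean_inner_merge) (use b i in auto)
    ultimately show ?thesis by simp
  next
    case False
    define t where "t = a \<bullet> b"
    have bb: "b \<bullet> b = 1" using b by simp
    have a: "a = t *\<^sub>R b"
      by (rule euclidean_eqI) (use False b in \<open>auto simp: t_def inner_Basis\<close>)
    have "\<exists>i \<in> Basis. i \<noteq> b"
    proof (rule ccontr)
      assume "\<not> ?thesis"
      then have "Basis \<subseteq> {b}" by auto
      then have "card (Basis :: 'a set) \<le> 1" using card_mono[of "{b}"] by auto
      with dim show False by simp
    qed
    then obtain i where i: "i \<in> Basis" "i \<noteq> b" by auto
    have bi: "i \<bullet> i = 1" "b \<bullet> i = 0" "i \<bullet> b = 0"
      using b i by (auto simp: inner_Basis)
    have "sphere_mean (\<lambda>x. f (x \<bullet> (t *\<^sub>R b))) = sphere_mean (\<lambda>x. f (x \<bullet> (\<bar>t\<bar> *\<^sub>R b)))"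
    proof (cases "t = 0")
      case False
      have "sphere_mean (\<lambda>x. f (x \<bullet> (t *\<^sub>R b))) = sphere_mean (\<lambda>x. f (x \<bullet> (\<bar>t\<bar> *\<^sub>R i)))"
        by (subst sphere_mean_inner_merge[of i b "t *\<^sub>R b"]) (use b i bi bb False in auto)
      also have "\<dots> = sphere_mean (\<lambda>x. f (x \<bullet> (\<bar>t\<bar> *\<^sub>R b)))"
        by (subst sphere_mean_inner_merge[of b i "\<bar>t\<bar> *\<^sub>R i"]) (use b i bi bb False in auto)
      finally show ?thesis .
    qed simp
    then show ?thesis using b by (simp add: a)
  qed
qed

text \<open>Every \<open>k\<close>-th moment is \<open>norm a ^ k\<close> times a constant
  \<open>M k\<close>. Odd constants vanish under \<open>b \<mapsto> - b\<close>; \<open>M 2\<close>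
  and \<open>M 4\<close> follow by averaging the sum of squared coordinates, which is 1 on the
  sphere, and its square.\<close>

lemma sphere_mean_moments:
  fixes a :: "'a::euclidean_space"
  assumes dim: "DIM('a) \<ge> 2"
  shows sphere_mean_odd_moment: "odd k \<Longrightarrow> sphere_mean (\<lambda>x. (x \<bullet> a) ^ k) = 0"
    and sphere_mean_moment_2: "sphere_mean (\<lambda>x. (x \<bullet> a)\<^sup>2) = (a \<bullet> a) / DIM('a)"
    and sphere_mean_moment_4:
      "sphere_mean (\<lambda>x. (x \<bullet> a) ^ 4) = 3 * (a \<bullet> a)\<^sup>2 / (DIM('a) * (DIM('a) + 2))"
proof -
  let ?n = "real DIM('a)"
  have n0: "?n > 0" using dim by linarith
  obtain b :: 'a where b: "b \<in> Basis" using nonempty_Basis by blast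
  define M where "M k = sphere_mean (\<lambda>x :: 'a. (x \<bullet> b) ^ k)" for k
  have mom: "sphere_mean (\<lambda>x. (x \<bullet> a) ^ k) = norm a ^ k * M k" for a :: 'a and k
    using sphere_mean_inner[OF b dim, of "\<lambda>t. t ^ k" a] by (simp add: M_def power_mult_distrib)
  have int: "set_integrable sphere_measure (sphere 0 1) f" if "continuous_on UNIV f" for f :: "'a \<Rightarrow> real"
    by (rule set_integrable_sphere[OF that])
  have sum_int: "sphere_mean (\<lambda>x. \<Sum>i\<in>I. g i x) = (\<Sum>i\<in>I. sphere_mean (g i))"
    if "finite I" "\<And>i. continuous_on UNIV (g i)" for I :: "'a set" and g :: "'a \<Rightarrow> 'a \<Rightarrow> real"
    using int[OF that(2)] unfolding set_lebesgue_integral_def set_integrable_def scaleR_sum_right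
    by (intro Bochner_Integration.integral_sum)
  show "sphere_mean (\<lambda>x. (x \<bullet> a) ^ k) = 0" if "odd k"
  proof -
    have "sphere_mean (\<lambda>x. (x \<bullet> (- b)) ^ k) = - M k"
      using that by (simp add: M_def power_minus_odd set_lebesgue_integral_def)
    moreover have "sphere_mean (\<lambda>x. (x \<bullet> (- b)) ^ k) = M k"
      using b by (subst mom) simp
    ultimately have "M k = 0" by linarith
    then show ?thesis by (simp add: mom)
  qed
  have unit: "(\<Sum>i\<in>Basis. (x \<bullet> i)\<^sup>2) = 1" if "norm x = 1" for x :: 'a
    using that euclidean_inner[of x x] by (simp add: norm_eq_sqrt_inner power2_eq_square)
  have "1 = sphere_mean (\<lambda>x :: 'a. \<Sum>i\<in>Basis. (x \<bullet> i)\<^sup>2)"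
    using sphere_mean_cong[of "\<lambda>x :: 'a. \<Sum>i\<in>Basis. (x \<bullet> i)\<^sup>2" "\<lambda>_. 1"] unit
    by (simp add: sphere_mean_const)
  also have "\<dots> = (\<Sum>i\<in>(Basis :: 'a set). sphere_mean (\<lambda>x :: 'a. (x \<bullet> i)\<^sup>2))"
    by (rule sum_int) (auto intro!: continuous_intros)
  also have "\<dots> = (\<Sum>i\<in>(Basis :: 'a set). M 2)"
    by (rule sum.cong) (auto simp: mom)
  finally have "M 2 = 1 / ?n"
    using n0 by (simp add: field_simps)
  then show "sphere_mean (\<lambda>x. (x \<bullet> a)\<^sup>2) = (a \<bullet> a) / ?n"
    by (simp add: mom power2_norm_eq_inner)
  have mixed: "sphere_mean (\<lambda>x. (x \<bullet> i)\<^sup>2 * (x \<bullet> j)\<^sup>2) = M 4 / 3"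
    if ij: "i \<in> Basis" "j \<in> Basis" "i \<noteq> j" for i j :: 'a
  proof -
    have ii: "i \<bullet> i = 1" "j \<bullet> j = 1" "i \<bullet> j = 0" "j \<bullet> i = 0"
      using ij by (auto simp: inner_Basis)
    have n4: "norm y ^ 4 = (y \<bullet> y)\<^sup>2" for y :: 'a
      using power2_norm_eq_inner[of y] by (metis numeral_Bit0 power_even_eq power2_eq_square power_add)
    have "norm (i + j) ^ 4 = 4" "norm (i - j) ^ 4 = 4"
      unfolding n4 by (simp_all add: inner_add_left inner_diff_left inner_add_right inner_diff_right ii)
    \<comment> \<open>The fourth moments along \<open>i + j\<close> and \<open>i - j\<close> are
      known by rotation invariance. In their sum the odd mixed terms cancel, which isolates the
      mixed moment.\<close>
    then have "8 * M 4 = sphere_mean (\<lambda>x. (x \<bullet> (i + j)) ^ 4) + sphere_mean (\<lambda>x. (x \<bullet> (i - j)) ^ 4)"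
      by (simp add: mom)
    also have "\<dots> = sphere_mean (\<lambda>x. (x \<bullet> (i + j)) ^ 4 + (x \<bullet> (i - j)) ^ 4)"
      by (rule set_integral_add(2)[symmetric]) (auto intro!: int continuous_intros)
    also have "\<dots> = sphere_mean (\<lambda>x. (2 * (x \<bullet> i) ^ 4 + 2 * (x \<bullet> j) ^ 4) + 12 * ((x \<bullet> i)\<^sup>2 * (x \<bullet> j)\<^sup>2))"
      by (rule sphere_mean_cong) (simp add: inner_add_right inner_diff_right power4_eq_xxxx
          power2_eq_square algebra_simps)
    also have "\<dots> = 2 * M 4 + 2 * M 4 + 12 * sphere_mean (\<lambda>x. (x \<bullet> i)\<^sup>2 * (x \<bullet> j)\<^sup>2)"
      using ij by (subst set_integral_add(2), (auto intro!: int continuous_intros)[2],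
          subst set_integral_add(2), (auto intro!: int continuous_intros)[2]) (simp add: mom)
    finally show ?thesis by simp
  qed
  have "1 = sphere_mean (\<lambda>x :: 'a. \<Sum>i\<in>Basis. \<Sum>j\<in>Basis. (x \<bullet> i)\<^sup>2 * (x \<bullet> j)\<^sup>2)"
    using sphere_mean_cong[of "\<lambda>x :: 'a. \<Sum>i\<in>Basis. \<Sum>j\<in>Basis. (x \<bullet> i)\<^sup>2 * (x \<bullet> j)\<^sup>2" "\<lambda>_. 1"] unit
    by (simp add: sphere_mean_const sum_product[symmetric])
  also have "\<dots> = (\<Sum>i\<in>(Basis :: 'a set). \<Sum>j\<in>Basis. sphere_mean (\<lambda>x :: 'a. (x \<bullet> i)\<^sup>2 * (x \<bullet> j)\<^sup>2))"
    by (subst sum_int, simp, (auto intro!: continuous_intros)[1], rule sum.cong[OF refl], rule sum_int)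
       (auto intro!: continuous_intros)
  also have "\<dots> = (\<Sum>i\<in>(Basis :: 'a set). \<Sum>j\<in>Basis. M 4 / 3 + (if i = j then 2 * M 4 / 3 else 0))"
  proof (intro sum.cong refl)
    fix i j :: 'a assume "i \<in> Basis" "j \<in> Basis"
    then show "sphere_mean (\<lambda>x. (x \<bullet> i)\<^sup>2 * (x \<bullet> j)\<^sup>2) = M 4 / 3 + (if i = j then 2 * M 4 / 3 else 0)"
      using mixed[of i j] mom[of i 4] by (auto simp: power_add[symmetric])
  qed
  also have "\<dots> = ?n * (?n * (M 4 / 3)) + ?n * (2 * M 4 / 3)"
    by (simp add: sum.distrib distrib_left)
  also have "\<dots> = ?n * (?n + 2) * M 4 / 3"
    by (simp add: field_simps)
  finally have "M 4 * (?n * (?n + 2)) = 3"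
    by (simp add: mult_ac)
  then have "M 4 = 3 / (?n * (?n + 2))"
    using n0 by (subst eq_divide_eq) auto
  moreover have "norm a ^ 4 = (a \<bullet> a)\<^sup>2"
    using power2_norm_eq_inner[of a] by (metis numeral_Bit0 power_even_eq power2_eq_square power_add)
  ultimately show "sphere_mean (\<lambda>x. (x \<bullet> a) ^ 4) = 3 * (a \<bullet> a)\<^sup>2 / (DIM('a) * (DIM('a) + 2))"
    by (simp add: mom algebra_simps)
qed

section \<open>Tight spherical 5-designs\<close>

lemma polynomial_of_degree_le_const: "polynomial_of_degree_le t (\<lambda>x :: real ^ 'n::finite. a)"
  unfolding polynomial_of_degree_le_def
proof (intro exI allI)
  fix x :: "real ^ 'n"
  have "(\<Sum>\<alpha> | (\<Sum>i\<in>UNIV. \<alpha> i) \<le> t. (if \<alpha> = (\<lambda>_. 0) then a else 0) * (\<Prod>i\<in>UNIV. x $ i ^ \<alpha> i))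
      = (\<Sum>\<alpha> | (\<Sum>i\<in>UNIV. \<alpha> i) \<le> t. if \<alpha> = (\<lambda>_ :: 'n. 0) then a else 0)"
    by (rule sum.cong) auto
  then show "a = (\<Sum>\<alpha> | (\<Sum>i\<in>UNIV. \<alpha> i) \<le> t.
      (if \<alpha> = (\<lambda>_ :: 'n. 0) then a else 0) * (\<Prod>i\<in>UNIV. x $ i ^ \<alpha> i))"
    using finite_exponents[of t, where 'n = 'n] by (simp add: sum.delta)
qed

lemma polynomial_of_degree_le_add:
  assumes "polynomial_of_degree_le t f" "polynomial_of_degree_le t g"
  shows "polynomial_of_degree_le t (\<lambda>x. f x + g x)"
proof -
  obtain c e where
    "\<And>x. f x = (\<Sum>\<alpha> | (\<Sum>i\<in>UNIV. \<alpha> i) \<le> t. c \<alpha> * (\<Prod>i\<in>UNIV. (x $ i) ^ \<alpha> i))"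
    "\<And>x. g x = (\<Sum>\<alpha> | (\<Sum>i\<in>UNIV. \<alpha> i) \<le> t. e \<alpha> * (\<Prod>i\<in>UNIV. (x $ i) ^ \<alpha> i))"
    using assms unfolding polynomial_of_degree_le_def by blast
  then show ?thesis
    unfolding polynomial_of_degree_le_def
    by (intro exI[of _ "\<lambda>\<alpha>. c \<alpha> + e \<alpha>"]) (simp add: distrib_right sum.distrib)
qed

lemma polynomial_of_degree_le_cmult:
  assumes "polynomial_of_degree_le t f"
  shows "polynomial_of_degree_le t (\<lambda>x. a * f x)"
proof -
  obtain c where
    "\<And>x. f x = (\<Sum>\<alpha> | (\<Sum>i\<in>UNIV. \<alpha> i) \<le> t. c \<alpha> * (\<Prod>i\<in>UNIV. (x $ i) ^ \<alpha> i))"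
    using assms unfolding polynomial_of_degree_le_def by blast
  then show ?thesis
    unfolding polynomial_of_degree_le_def
    by (intro exI[of _ "\<lambda>\<alpha>. a * c \<alpha>"]) (simp add: sum_distrib_left mult.assoc)
qed

lemma polynomial_of_degree_le_sum:
  assumes "\<And>i. i \<in> I \<Longrightarrow> polynomial_of_degree_le t (f i)"
  shows "polynomial_of_degree_le t (\<lambda>x. \<Sum>i\<in>I. f i x)"
  using assms
  by (induction I rule: infinite_finite_induct)
     (auto intro: polynomial_of_degree_le_const polynomial_of_degree_le_add)

lemma polynomial_of_degree_le_coord_mult:
  fixes f :: "real ^ 'n::finite \<Rightarrow> real"
  assumes "polynomial_of_degree_le t f"
  shows "polynomial_of_degree_le (Suc t) (\<lambda>x. x $ k * f x)"
proof -
  obtain c where c: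
    "\<And>x. f x = (\<Sum>\<alpha> | (\<Sum>i\<in>UNIV. \<alpha> i) \<le> t. c \<alpha> * (\<Prod>i\<in>UNIV. (x $ i) ^ \<alpha> i))"
    using assms unfolding polynomial_of_degree_le_def by blast
  \<comment> \<open>Multiplication by the \<open>k\<close>-th coordinate raises its exponent by one.
    Monomials free of that coordinate need an explicit zero, since the truncated
    \<open>\<beta> k - 1\<close> would otherwise return \<open>c \<beta>\<close>.\<close>
  define c' where "c' \<beta> = (if \<beta> k > 0 then c (\<beta>(k := \<beta> k - 1)) else 0)" for \<beta>
  have total: "(\<Sum>i\<in>UNIV. \<alpha> i) = \<alpha> k + (\<Sum>i\<in>UNIV - {k}. \<alpha> i)" for \<alpha> :: "'n \<Rightarrow> nat"
    by (subst sum.remove[of _ k]) auto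
  have mon: "(\<Prod>i\<in>UNIV. (x $ i) ^ \<alpha> i) = x $ k ^ \<alpha> k * (\<Prod>i\<in>UNIV - {k}. (x $ i) ^ \<alpha> i)"
    for \<alpha> and x :: "real ^ 'n"
    by (subst prod.remove[of _ k]) auto
  have upd: "(\<Sum>i\<in>UNIV - {k}. (\<alpha>(k := j)) i) = (\<Sum>i\<in>UNIV - {k}. \<alpha> i)" for \<alpha> :: "'n \<Rightarrow> nat" and j
    by (rule sum.cong) auto
  have updp: "(\<Prod>i\<in>UNIV - {k}. (x $ i) ^ (\<alpha>(k := j)) i) = (\<Prod>i\<in>UNIV - {k}. (x $ i) ^ \<alpha> i)"
    for \<alpha> j and x :: "real ^ 'n"
    by (rule prod.cong) auto
  have "x $ k * f x = (\<Sum>\<beta> | (\<Sum>i\<in>UNIV. \<beta> i) \<le> Suc t. c' \<beta> * (\<Prod>i\<in>UNIV. (x $ i) ^ \<beta> i))" for x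
  proof -
    have "(\<Sum>\<beta> | (\<Sum>i\<in>UNIV. \<beta> i) \<le> Suc t. c' \<beta> * (\<Prod>i\<in>UNIV. (x $ i) ^ \<beta> i)) =
        (\<Sum>\<beta> | (\<Sum>i\<in>UNIV. \<beta> i) \<le> Suc t \<and> \<beta> k > 0. c' \<beta> * (\<Prod>i\<in>UNIV. (x $ i) ^ \<beta> i))"
      by (rule sum.mono_neutral_right[OF finite_exponents]) (auto simp: c'_def)
    also have "\<dots> = (\<Sum>\<alpha> | (\<Sum>i\<in>UNIV. \<alpha> i) \<le> t. x $ k * (c \<alpha> * (\<Prod>i\<in>UNIV. (x $ i) ^ \<alpha> i)))"
    proof (rule sum.reindex_bij_witness[of _ "\<lambda>\<alpha>. \<alpha>(k := Suc (\<alpha> k))" "\<lambda>\<beta>. \<beta>(k := \<beta> k - 1)"])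
      fix \<beta> :: "'n \<Rightarrow> nat" assume "\<beta> \<in> {\<beta>. (\<Sum>i\<in>UNIV. \<beta> i) \<le> Suc t \<and> \<beta> k > 0}"
      then have \<beta>: "(\<Sum>i\<in>UNIV. \<beta> i) \<le> Suc t" "\<beta> k > 0" by auto
      then obtain j where j: "\<beta> k = Suc j" by (cases "\<beta> k") auto
      show "(\<beta>(k := \<beta> k - 1))(k := Suc ((\<beta>(k := \<beta> k - 1)) k)) = \<beta>"
        by (simp add: j fun_eq_iff)
      have "(\<Sum>i\<in>UNIV. (\<beta>(k := \<beta> k - 1)) i) = j + (\<Sum>i\<in>UNIV - {k}. \<beta> i)"
        by (subst total, subst upd) (simp add: j)
      then show "\<beta>(k := \<beta> k - 1) \<in> {\<alpha>. (\<Sum>i\<in>UNIV. \<alpha> i) \<le> t}"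
        using \<beta>(1) by (simp only: mem_Collect_eq, subst (asm) total) (simp add: j)
      show "x $ k * (c (\<beta>(k := \<beta> k - 1)) * (\<Prod>i\<in>UNIV. (x $ i) ^ (\<beta>(k := \<beta> k - 1)) i)) =
          c' \<beta> * (\<Prod>i\<in>UNIV. (x $ i) ^ \<beta> i)"
        unfolding mon[of x \<beta>] mon[of x "\<beta>(k := \<beta> k - 1)"] updp by (simp add: c'_def j)
    next
      fix \<alpha> :: "'n \<Rightarrow> nat" assume "\<alpha> \<in> {\<alpha>. (\<Sum>i\<in>UNIV. \<alpha> i) \<le> t}"
      then have \<alpha>: "\<alpha> k + (\<Sum>i\<in>UNIV - {k}. \<alpha> i) \<le> t"
        using total[of \<alpha>] by simp
      have "(\<Sum>i\<in>UNIV. (\<alpha>(k := Suc (\<alpha> k))) i) = Suc (\<alpha> k) + (\<Sum>i\<in>UNIV - {k}. \<alpha> i)"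
        by (subst total, subst upd) simp
      then show "\<alpha>(k := Suc (\<alpha> k)) \<in> {\<beta>. (\<Sum>i\<in>UNIV. \<beta> i) \<le> Suc t \<and> \<beta> k > 0}"
        using \<alpha> by simp
    qed simp
    finally show ?thesis
      by (simp add: c sum_distrib_left)
  qed
  then show ?thesis
    unfolding polynomial_of_degree_le_def by blast
qed

lemma polynomial_of_degree_le_mono:
  assumes "polynomial_of_degree_le s f" "s \<le> t"
  shows "polynomial_of_degree_le t f"
proof -
  obtain c where
    "\<And>x. f x = (\<Sum>\<alpha> | (\<Sum>i\<in>UNIV. \<alpha> i) \<le> s. c \<alpha> * (\<Prod>i\<in>UNIV. (x $ i) ^ \<alpha> i))"
    using assms unfolding polynomial_of_degree_le_def by blast
  moreover have "(\<Sum>\<alpha> | (\<Sum>i\<in>UNIV. \<alpha> i) \<le> t.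
      (if (\<Sum>i\<in>UNIV. \<alpha> i) \<le> s then c \<alpha> else 0) * (\<Prod>i\<in>UNIV. (x $ i) ^ \<alpha> i)) =
      (\<Sum>\<alpha> | (\<Sum>i\<in>UNIV. \<alpha> i) \<le> s. c \<alpha> * (\<Prod>i\<in>UNIV. (x $ i) ^ \<alpha> i))" for x
    using \<open>s \<le> t\<close> by (intro sum.mono_neutral_cong_right finite_exponents) auto
  ultimately show ?thesis
    unfolding polynomial_of_degree_le_def
    by (intro exI[of _ "\<lambda>\<alpha>. if (\<Sum>i\<in>UNIV. \<alpha> i) \<le> s then c \<alpha> else 0"]) simp
qed

text \<open>Powers of linear forms are the only test functions to which the design property is
  applied.\<close>

lemma polynomial_of_degree_le_inner_power:
  "polynomial_of_degree_le k (\<lambda>x :: real ^ 'n::finite. (x \<bullet> a) ^ k)"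
proof (induction k)
  case 0
  then show ?case by (simp add: polynomial_of_degree_le_const)
next
  case (Suc k)
  have "(x \<bullet> a) ^ Suc k = (\<Sum>i\<in>UNIV. a $ i * (x $ i * (x \<bullet> a) ^ k))" for x
    by (simp add: inner_vec_def sum_distrib_right mult_ac)
  then show ?case
    by (simp del: power_Suc)
       (intro polynomial_of_degree_le_sum polynomial_of_degree_le_cmult
         polynomial_of_degree_le_coord_mult Suc)
qed

lemma spherical_design_moments:
  fixes D :: "(real ^ 'n::finite) set"
  assumes D: "spherical_design 5 D" and n: "CARD('n) \<ge> 2"
  shows spherical_design_odd_moment: "odd k \<Longrightarrow> k \<le> 5 \<Longrightarrow> (\<Sum>x\<in>D. (x \<bullet> a) ^ k) = 0"
    and spherical_design_moment_2: "(\<Sum>x\<in>D. (x \<bullet> a)\<^sup>2) = card D * (a \<bullet> a) / CARD('n)"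
    and spherical_design_moment_4:
      "(\<Sum>x\<in>D. (x \<bullet> a) ^ 4) = card D * (3 * (a \<bullet> a)\<^sup>2) / (CARD('n) * (CARD('n) + 2))"
proof -
  have dim: "DIM(real ^ 'n) \<ge> 2" using n by simp
  have c: "card D > 0"
    using D by (auto simp: spherical_design_def card_gt_0_iff)
  have mom: "(\<Sum>x\<in>D. (x \<bullet> a) ^ k) = card D * sphere_mean (\<lambda>x. (x \<bullet> a) ^ k)" if "k \<le> 5" for k
    using D c polynomial_of_degree_le_mono[OF polynomial_of_degree_le_inner_power that, of a]
    by (auto simp: spherical_design_def field_simps)
  show "(\<Sum>x\<in>D. (x \<bullet> a) ^ k) = 0" if "odd k" "k \<le> 5"
    using that by (simp add: mom sphere_mean_odd_moment[OF dim])
  show "(\<Sum>x\<in>D. (x \<bullet> a)\<^sup>2) = card D * (a \<bullet> a) / CARD('n)"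
    by (simp add: mom sphere_mean_moment_2[OF dim])
  show "(\<Sum>x\<in>D. (x \<bullet> a) ^ 4) = card D * (3 * (a \<bullet> a)\<^sup>2) / (CARD('n) * (CARD('n) + 2))"
    by (simp add: mom sphere_mean_moment_4[OF dim])
qed

text \<open>Averaging \<open>(t + 1) (t\<^sup>2 - 1 / (n + 2))\<^sup>2\<close>, nonnegative on \<open>[-1, 1]\<close>, over the inner products with
  \<open>x \<in> D\<close> gives exactly the contribution of \<open>x\<close> itself, so all other terms vanish.\<close>

lemma tight_spherical_5_design_inner:
  fixes D :: "(real ^ 'n::finite) set"
  assumes D: "tight_spherical_5_design D" and n: "CARD('n) \<ge> 2" and x: "x \<in> D"
  shows "- x \<in> D" and "\<And>y. y \<in> D \<Longrightarrow> y \<noteq> x \<Longrightarrow> y \<noteq> - x \<Longrightarrow> (x \<bullet> y)\<^sup>2 = 1 / (CARD('n) + 2)"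
proof -
  let ?n = "real CARD('n)"
  have n0: "?n > 0" by simp
  define a where "a = 1 / (?n + 2)"
  have a: "0 < a" "a < 1" using n by (auto simp: a_def)
  have D5: "spherical_design 5 D" and cD: "real (card D) = ?n * (?n + 1)"
    using D by (auto simp: tight_spherical_5_design_def algebra_simps)
  have fin: "finite D" and sph: "\<And>y. y \<in> D \<Longrightarrow> y \<bullet> y = 1"
    using D5 by (auto simp: spherical_design_def norm_eq_1)
  define S where "S k = (\<Sum>y\<in>D. (y \<bullet> x) ^ k)" for k
  have S: "S 0 = ?n * (?n + 1)" "S 1 = 0" "S 2 = ?n + 1" "S 3 = 0" "S 4 = 3 * (?n + 1) / (?n + 2)" "S 5 = 0"
  proof -
    show "S 0 = ?n * (?n + 1)" using cD by (simp add: S_def)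
    show "S 1 = 0" "S 3 = 0" "S 5 = 0"
      unfolding S_def by (rule spherical_design_odd_moment[OF D5 n]; simp)+
    show "S 2 = ?n + 1"
      using spherical_design_moment_2[OF D5 n, of x] sph[OF x] n0 cD by (simp add: S_def)
    have "real (CARD('n) * (CARD('n) + 2)) = ?n * (?n + 2)"
      by (simp add: algebra_simps)
    with spherical_design_moment_4[OF D5 n, of x]
    have "S 4 = ?n * (?n + 1) * 3 / (?n * (?n + 2))"
      unfolding cD sph[OF x] S_def by simp
    also have "\<dots> = (?n * (3 * (?n + 1))) / (?n * (?n + 2))"
      by (simp only: mult_ac)
    finally show "S 4 = 3 * (?n + 1) / (?n + 2)"
      using n0 by (subst (asm) mult_divide_mult_cancel_left) auto
  qed
  \<comment> \<open>The factor \<open>e\<close> serves two choices: \<open>e = 1\<close> gives the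
    nonnegative polynomial that fixes the inner products, and \<open>e = -1\<close> then forces
    \<open>- x\<close> into \<open>D\<close>.\<close>
  have sum_eq: "(\<Sum>y\<in>D. (y \<bullet> x + e) * ((y \<bullet> x)\<^sup>2 - a)\<^sup>2) =
      e * (2 * (?n + 1)\<^sup>2 / (?n + 2)\<^sup>2)" for e
  proof -
    have "(\<Sum>y\<in>D. (y \<bullet> x + e) * ((y \<bullet> x)\<^sup>2 - a)\<^sup>2) =
        (\<Sum>y\<in>D. ((y \<bullet> x) ^ 5 + e * (y \<bullet> x) ^ 4 + (- 2 * a) * (y \<bullet> x) ^ 3
          + (- 2 * a * e) * (y \<bullet> x) ^ 2 + a\<^sup>2 * (y \<bullet> x) ^ 1 + (a\<^sup>2 * e) * (y \<bullet> x) ^ 0))"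
      by (rule sum.cong) (auto simp: power2_eq_square algebra_simps power_numeral_reduce)
    also have "\<dots> = S 5 + e * S 4 + (- 2 * a) * S 3 + (- 2 * a * e) * S 2 + a\<^sup>2 * S 1 + (a\<^sup>2 * e) * S 0"
      by (simp only: sum.distrib sum_distrib_left[symmetric] S_def)
    also have "\<dots> = e * (3 * (?n + 1) * a - 2 * a * (?n + 1) + a\<^sup>2 * (?n * (?n + 1)))"
      unfolding S by (simp add: a_def algebra_simps add_divide_distrib)
    also have "3 * (?n + 1) * a - 2 * a * (?n + 1) + a\<^sup>2 * (?n * (?n + 1)) = (?n + 1) * a * (1 + ?n * a)"
      by (simp add: power2_eq_square algebra_simps)
    also have "1 + ?n * a = 2 * (?n + 1) * a"
      using n0 by (simp add: a_def field_simps)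
    finally show ?thesis
      by (simp add: a_def power2_eq_square)
  qed
  have "1 - a = (?n + 1) / (?n + 2)"
    using n0 by (simp add: a_def field_simps)
  then have F1: "2 * (1 - a)\<^sup>2 = 2 * (?n + 1)\<^sup>2 / (?n + 2)\<^sup>2"
    by (simp add: power_divide)
  have ge: "-1 \<le> y \<bullet> x" "y \<bullet> x = -1 \<Longrightarrow> y = - x" if "y \<in> D" for y
  proof -
    have "0 \<le> (y + x) \<bullet> (y + x)" by simp
    also have e: "(y + x) \<bullet> (y + x) = 2 * (1 + y \<bullet> x)"
      using sph[OF that] sph[OF x] by (simp add: inner_add_left inner_add_right inner_commute[of x y])
    finally show "-1 \<le> y \<bullet> x" by simp
    show "y = - x" if "y \<bullet> x = -1"
    proof -
      have "(y + x) \<bullet> (y + x) = 0" using e that by simp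
      then have "y + x = 0" by simp
      then show ?thesis by (simp add: eq_neg_iff_add_eq_0)
    qed
  qed
  define h where "h y = (y \<bullet> x + 1) * ((y \<bullet> x)\<^sup>2 - a)\<^sup>2" for y
  have "(\<Sum>y\<in>D. h y) = h x + (\<Sum>y\<in>D - {x}. h y)"
    using fin x by (rule sum.remove)
  moreover have "(\<Sum>y\<in>D. h y) = h x"
    using sum_eq[of 1] F1 sph[OF x] by (simp add: h_def)
  ultimately have "(\<Sum>y\<in>D - {x}. h y) = 0"
    by simp
  moreover have "h y \<ge> 0" if "y \<in> D" for y
    using ge(1)[OF that] by (simp add: h_def)
  ultimately have h0: "h y = 0" if "y \<in> D" "y \<noteq> x" for y
    using that fin by (subst (asm) sum_nonneg_eq_0_iff) auto
  then show eq: "(x \<bullet> y)\<^sup>2 = 1 / (CARD('n) + 2)" if "y \<in> D" "y \<noteq> x" "y \<noteq> - x" for y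
    using h0[OF that(1,2)] ge(2)[OF that(1)] that(3)
    by (auto simp: h_def a_def inner_commute[of x y] add_eq_0_iff add.commute)
  show "- x \<in> D"
  proof (rule ccontr)
    assume nx: "- x \<notin> D"
    \<comment> \<open>With \<open>e = -1\<close> the linear factor kills the term of
      \<open>x\<close>, and the quadratic factor kills all others if \<open>- x\<close> is missing,
      although the total is nonzero.\<close>
    have "(\<Sum>y\<in>D. (y \<bullet> x + (- 1)) * ((y \<bullet> x)\<^sup>2 - a)\<^sup>2) = 0"
    proof (rule sum.neutral, intro ballI)
      fix y assume "y \<in> D"
      then show "(y \<bullet> x + (- 1)) * ((y \<bullet> x)\<^sup>2 - a)\<^sup>2 = 0"
        using eq[of y] nx sph[OF x] by (cases "y = x") (auto simp: a_def inner_commute[of x y] add.commute)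
    qed
    then have "2 * (1 - a)\<^sup>2 = 0"
      unfolding sum_eq F1 by simp
    with a show False by simp
  qed
qed

section \<open>Numbers integral at a prime\<close>

text \<open>For prime \<open>p\<close> this is the localization of the integers at \<open>p\<close>,
  taken inside the reals so that inner products and determinants can be tested without any p-adic
  numbers.\<close>

definition p_integral :: "nat \<Rightarrow> real set" where
  "p_integral p = {x. \<exists>a b :: int. \<not> int p dvd b \<and> x = of_int a / of_int b}"

lemma p_integralE:
  assumes "x \<in> p_integral p"
  obtains a b :: int where "\<not> int p dvd b" "b \<noteq> 0" "x = of_int a / of_int b"
proof -
  obtain a b :: int where "\<not> int p dvd b" "x = of_int a / of_int b"
    using assms by (auto simp: p_integral_def)
  moreover from this have "b \<noteq> 0" by (metis dvd_0_right)
  ultimately show ?thesis using that by blast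
qed

lemma p_integralI: "\<not> int p dvd b \<Longrightarrow> x = of_int a / of_int b \<Longrightarrow> x \<in> p_integral p"
  by (auto simp: p_integral_def)

context
  fixes p :: nat
  assumes p: "prime p"
begin

lemma p_integral_of_int: "of_int a \<in> p_integral p"
  by (rule p_integralI[of p 1 _ a]) (use p in \<open>auto simp: prime_gt_1_nat\<close>)

lemma p_integral_Ints: "x \<in> \<int> \<Longrightarrow> x \<in> p_integral p"
  by (auto elim!: Ints_cases intro: p_integral_of_int)

lemma p_integral_0: "0 \<in> p_integral p" and p_integral_1: "1 \<in> p_integral p"
  and p_integral_numeral: "numeral w \<in> p_integral p"
  and p_integral_of_nat: "of_nat k \<in> p_integral p"
  by (auto intro: p_integral_Ints)

lemma p_integral_add:
  assumes "x \<in> p_integral p" "y \<in> p_integral p"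
  shows "x + y \<in> p_integral p"
proof -
  obtain a b c d :: int where *: "\<not> int p dvd b" "b \<noteq> 0" "x = of_int a / of_int b"
    "\<not> int p dvd d" "d \<noteq> 0" "y = of_int c / of_int d"
    using assms by (metis p_integralE)
  show ?thesis
    by (rule p_integralI[of p "b * d" _ "a * d + c * b"])
       (use * p in \<open>auto simp: prime_dvd_mult_iff field_simps\<close>)
qed

lemma p_integral_mult:
  assumes "x \<in> p_integral p" "y \<in> p_integral p"
  shows "x * y \<in> p_integral p"
proof -
  obtain a b c d :: int where *: "\<not> int p dvd b" "b \<noteq> 0" "x = of_int a / of_int b"
    "\<not> int p dvd d" "d \<noteq> 0" "y = of_int c / of_int d"
    using assms by (metis p_integralE)
  show ?thesis
    by (rule p_integralI[of p "b * d" _ "a * c"])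
       (use * p in \<open>auto simp: prime_dvd_mult_iff field_simps\<close>)
qed

lemma p_integral_minus: "x \<in> p_integral p \<Longrightarrow> - x \<in> p_integral p"
  using p_integral_mult[OF p_integral_of_int[of "-1"]] by simp

lemma p_integral_diff: "x \<in> p_integral p \<Longrightarrow> y \<in> p_integral p \<Longrightarrow> x - y \<in> p_integral p"
  using p_integral_add[OF _ p_integral_minus] by fastforce

lemma p_integral_power: "x \<in> p_integral p \<Longrightarrow> x ^ k \<in> p_integral p"
  by (induction k) (auto intro: p_integral_1 p_integral_mult)

lemma p_integral_sum: "(\<And>i. i \<in> I \<Longrightarrow> f i \<in> p_integral p) \<Longrightarrow> sum f I \<in> p_integral p"
  by (induction I rule: infinite_finite_induct) (auto intro: p_integral_0 p_integral_add)

lemma p_integral_prod: "(\<And>i. i \<in> I \<Longrightarrow> f i \<in> p_integral p) \<Longrightarrow> prod f I \<in> p_integral p"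
  by (induction I rule: infinite_finite_induct) (auto intro: p_integral_1 p_integral_mult)

lemma p_integral_det:
  fixes A :: "real ^ 'n ^ 'n::finite"
  assumes "\<And>i j. A $ i $ j \<in> p_integral p"
  shows "det A \<in> p_integral p"
  unfolding det_def
  by (intro p_integral_sum p_integral_mult p_integral_prod p_integral_of_int assms)

lemma p_integral_divide_of_int:
  assumes "x \<in> p_integral p" "\<not> int p dvd s"
  shows "x / of_int s \<in> p_integral p"
proof -
  have "1 / of_int s \<in> p_integral p"
    by (rule p_integralI[of p s _ 1]) (use assms in auto)
  then show ?thesis
    using p_integral_mult[OF assms(1)] by fastforce
qed

text \<open>Scaling by \<open>s\<close> turns inner products that are only \<open>p\<close>-integral
  into integers, to which divisibility of integer polynomial values applies, and changes nothing at
  \<open>p\<close>.\<close>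

lemma p_integral_common_denominator:
  assumes "finite I" "\<And>i. i \<in> I \<Longrightarrow> f i \<in> p_integral p"
  obtains s :: int where "\<not> int p dvd s" "\<And>i. i \<in> I \<Longrightarrow> of_int s * f i \<in> \<int>"
proof -
  have "\<exists>s :: int. \<not> int p dvd s \<and> (\<forall>i\<in>I. of_int s * f i \<in> \<int>)"
    using assms
  proof (induction I rule: finite_induct)
    case empty
    then show ?case
      using p by (intro exI[of _ 1]) (auto simp: prime_gt_1_nat)
  next
    case (insert i I)
    obtain s :: int where s: "\<not> int p dvd s" "\<forall>i\<in>I. of_int s * f i \<in> \<int>"
      using insert by auto
    have "f i \<in> p_integral p" using insert by auto
    then obtain a b :: int where b: "\<not> int p dvd b" "b \<noteq> 0" "f i = of_int a / of_int b"
      by (rule p_integralE)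
    have "of_int (b * s) * f j \<in> \<int>" if "j \<in> insert i I" for j
    proof (cases "j = i")
      case True
      have "of_int (b * s) * f i = of_int (s * a)" using b by simp
      then show ?thesis using True by (metis Ints_of_int)
    next
      case False
      then have "of_int s * f j \<in> \<int>"
        using that s by auto
      from Ints_mult[OF Ints_of_int[of b] this] have "of_int b * (of_int s * f j) \<in> \<int>" .
      then show ?thesis by (simp add: mult.assoc)
    qed
    moreover have "\<not> int p dvd b * s"
      using p b s by (simp add: prime_dvd_mult_iff)
    ultimately show ?case by blast
  qed
  then show ?thesis using that by blast
qed

lemma of_int_divide_p_integralD: "of_int a / p \<in> p_integral p \<Longrightarrow> int p dvd a"
proof -
  assume "of_int a / p \<in> p_integral p"
  then obtain c b :: int where b: "\<not> int p dvd b" "b \<noteq> 0" "of_int a / p = (of_int c / of_int b :: real)"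
    by (rule p_integralE)
  have "real p \<noteq> 0" using p by (auto simp: prime_gt_0_nat)
  with b have "(of_int (a * b) :: real) = of_int (int p * c)"
    by (simp add: field_simps)
  then have "a * b = int p * c" by (simp only: of_int_eq_iff)
  then have "int p dvd a * b" by simp
  with p b show ?thesis by (simp add: prime_dvd_mult_iff)
qed

end

lemma Ints_det:
  fixes A :: "real ^ 'n ^ 'n::finite"
  assumes "\<And>i j. A $ i $ j \<in> \<int>"
  shows "det A \<in> \<int>"
  unfolding det_def by (intro Ints_sum Ints_mult Ints_prod Ints_of_int assms)

lemmas p2_intros = p_integral_0[OF two_is_prime_nat] p_integral_1[OF two_is_prime_nat]
  p_integral_numeral[OF two_is_prime_nat] p_integral_of_int[OF two_is_prime_nat]
  p_integral_add[OF two_is_prime_nat] p_integral_mult[OF two_is_prime_nat]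
  p_integral_minus[OF two_is_prime_nat] p_integral_diff[OF two_is_prime_nat]
  p_integral_power[OF two_is_prime_nat] p_integral_of_nat[OF two_is_prime_nat]

section \<open>Congruences modulo 4 for 2-adic units\<close>

abbreviation cong4 :: "real \<Rightarrow> real \<Rightarrow> bool" where
  "cong4 x y \<equiv> (x - y) / 4 \<in> p_integral 2"

lemma cong4_mult:
  assumes "cong4 x (of_int a)" "cong4 y (of_int b)"
  shows "cong4 (x * y) (of_int (a * b))"
proof -
  have "(x * y - of_int (a * b)) / 4 =
      4 * ((x - a) / 4) * ((y - b) / 4) + of_int b * ((x - a) / 4) + of_int a * ((y - b) / 4)"
    by (simp add: field_simps)
  moreover have "\<dots> \<in> p_integral 2"
    using assms by (intro p2_intros)
  ultimately show ?thesis by (simp only:)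
qed

lemma p2_unitE:
  assumes "x \<in> p_integral 2" "x / 2 \<notin> p_integral 2"
  obtains a b :: int where "odd a" "odd b" "x = of_int a / of_int b"
proof -
  obtain a b :: int where b: "odd b" "b \<noteq> 0" "x = of_int a / of_int b"
    using assms(1) by (auto elim: p_integralE)
  have "odd a"
  proof
    assume "even a"
    then obtain c where "a = 2 * c" by blast
    then have "x / 2 = of_int c / of_int b" using b by simp
    then have "x / 2 \<in> p_integral 2" using b by (auto intro: p_integralI)
    with assms show False by simp
  qed
  with b that show ?thesis by blast
qed

text \<open>A unit is a quotient of odd integers, and squares of odd integers agree modulo 4. Hence
  a base change, which multiplies a Gram determinant by the square of a unit, keeps its class modulo
  4.\<close>

lemma p2_unit_cong4:
  assumes "x \<in> p_integral 2" "x / 2 \<notin> p_integral 2"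
  shows "cong4 (x\<^sup>2) 1" and "1 / x \<in> p_integral 2"
proof -
  obtain a b :: int where ab: "odd a" "odd b" "x = of_int a / of_int b"
    using assms by (rule p2_unitE)
  show "1 / x \<in> p_integral 2"
    using ab by (auto intro: p_integralI[of 2 a _ b])
  obtain k l where kl: "a = 2 * k + 1" "b = 2 * l + 1" using ab by (metis oddE)
  have "b \<noteq> 0" using ab by auto
  then have "x\<^sup>2 - 1 = (of_int (a\<^sup>2 - b\<^sup>2)) / of_int (b\<^sup>2)"
    using ab by (simp add: power_divide diff_divide_distrib)
  also define c where "c = k\<^sup>2 + k - l\<^sup>2 - l"
  have "a\<^sup>2 - b\<^sup>2 = 4 * c"
    by (simp add: kl c_def power2_eq_square algebra_simps)
  finally have "(x\<^sup>2 - 1) / 4 = of_int c / of_int (b\<^sup>2)"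
    by simp
  then show "cong4 (x\<^sup>2) 1"
    by (rule p_integralI[of 2 "b\<^sup>2", rotated]) (use ab in auto)
qed

lemma half_not_p2: "1 / 2 \<notin> p_integral 2"
  using of_int_divide_p_integralD[OF two_is_prime_nat, of 1] by auto

lemma cong4_unit:
  assumes "cong4 x (of_int e)" "odd e"
  shows "x \<in> p_integral 2" "x / 2 \<notin> p_integral 2"
proof -
  have "4 * ((x - e) / 4) + of_int e \<in> p_integral 2"
    using assms(1) by (intro p2_intros)
  moreover have "4 * ((x - e) / 4) + of_int e = x" by (simp add: field_simps)
  ultimately show "x \<in> p_integral 2" by (simp only:)
  show "x / 2 \<notin> p_integral 2"
  proof
    assume "x / 2 \<in> p_integral 2"
    then have "x / 2 - 2 * ((x - e) / 4) \<in> p_integral 2"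
      using assms(1) by (intro p2_intros)
    moreover have "x / 2 - 2 * ((x - e) / 4) = of_int e / real 2" by (simp add: field_simps)
    ultimately have "of_int e / real 2 \<in> p_integral 2" by (simp only:)
    then have "int 2 dvd e"
      by (rule of_int_divide_p_integralD[OF two_is_prime_nat])
    with assms(2) show False by simp
  qed
qed

lemma cong4_inverse:
  assumes "cong4 x (of_int e)" "e = 1 \<or> e = -1"
  shows "cong4 (1 / x) (of_int e)"
proof -
  have e: "odd e" "e * e = 1" using assms(2) by auto
  have x: "1 / x \<in> p_integral 2" "x \<noteq> 0"
    using p2_unit_cong4(2)[OF cong4_unit[OF assms(1) e(1)]] cong4_unit(2)[OF assms(1) e(1)]
    by (auto intro: p_integral_0[OF two_is_prime_nat])
  have "(1 / x - of_int e) / 4 = - (of_int e * (1 / x) * ((x - of_int e) / 4))"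
    using x e(2) by (simp add: field_simps flip: of_int_mult)
  also have "\<dots> \<in> p_integral 2"
    using x assms(1) by (intro p2_intros)
  finally show ?thesis .
qed

text \<open>\<open>mat 1 + N\<close> will be an elimination matrix with inverse
  \<open>mat 1 - N\<close>. Its determinant enters only squared, so it suffices that it is a 2-adic
  unit.\<close>

lemma det_unipotent:
  fixes N :: "real ^ 'n ^ 'n::finite"
  assumes "\<And>i j. N $ i $ j \<in> p_integral 2" "N ** N = 0"
  shows "cong4 ((det (mat 1 + N))\<^sup>2) 1" "det (mat 1 + N) * det (mat 1 - N) = 1"
proof -
  have "(mat 1 + N) ** (mat 1 - N) = mat 1"
  proof (subst matrix_eq, intro allI)
    fix x
    have "N *v (N *v x) = 0"
      using assms(2) by (simp add: matrix_vector_mul_assoc)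
    then show "((mat 1 + N) ** (mat 1 - N)) *v x = mat 1 *v x"
      by (simp add: matrix_vector_mul_assoc[symmetric] algebra_simps)
  qed
  then show prod: "det (mat 1 + N) * det (mat 1 - N) = 1"
    by (simp flip: det_mul)
  have int: "det (mat 1 + N) \<in> p_integral 2" "det (mat 1 - N) \<in> p_integral 2"
    using assms(1) by (auto intro!: p_integral_det p2_intros simp: mat_def)
  have "det (mat 1 + N) / 2 \<notin> p_integral 2"
  proof
    assume "det (mat 1 + N) / 2 \<in> p_integral 2"
    then have "det (mat 1 + N) / 2 * det (mat 1 - N) \<in> p_integral 2"
      using int by (intro p2_intros)
    then show False using prod half_not_p2 by simp
  qed
  with int show "cong4 ((det (mat 1 + N))\<^sup>2) 1"
    by (intro p2_unit_cong4)
qed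

text \<open>A permutation moving an index outside \<open>{i, j}\<close> meets a zero entry there, so
  only the identity and the transposition survive in the Leibniz sum.\<close>

lemma det_plane:
  fixes A :: "real ^ 'n ^ 'n::finite"
  assumes ij: "i \<noteq> j" and A: "\<And>k l. k \<notin> {i, j} \<Longrightarrow> A $ k $ l = (if k = l then 1 else 0)"
  shows "det A = A $ i $ i * A $ j $ j - A $ i $ j * A $ j $ i"
proof -
  let ?t = "\<lambda>\<sigma>. of_int (sign \<sigma>) * (\<Prod>k\<in>UNIV. A $ k $ \<sigma> k)"
  have split: "(\<Prod>k\<in>UNIV. A $ k $ \<sigma> k) = A $ i $ \<sigma> i * (A $ j $ \<sigma> j * (\<Prod>k\<in>UNIV - {i} - {j}. A $ k $ \<sigma> k))" for \<sigma>
    using ij by (subst prod.remove[of _ i], simp, simp, subst prod.remove[of _ j]) auto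
  have "det A = sum ?t {\<sigma>. \<sigma> permutes UNIV}" by (simp add: det_def)
  also have "\<dots> = sum ?t {id, Transposition.transpose i j}"
  proof (rule sum.mono_neutral_right)
    show "{id, Transposition.transpose i j} \<subseteq> {\<sigma>. \<sigma> permutes UNIV}"
      by (auto intro: permutes_id permutes_swap_id)
    show "\<forall>\<sigma>\<in>{\<sigma>. \<sigma> permutes UNIV} - {id, Transposition.transpose i j}. ?t \<sigma> = 0"
    proof
      fix \<sigma> assume \<sigma>: "\<sigma> \<in> {\<sigma>. \<sigma> permutes (UNIV :: 'n set)} - {id, Transposition.transpose i j}"
      have "\<exists>k. k \<notin> {i, j} \<and> \<sigma> k \<noteq> k"
      proof (rule ccontr)
        assume "\<not> ?thesis"
        then have "\<sigma> permutes {i, j}"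
          using \<sigma> by (auto simp: permutes_def)
        then have "\<sigma> \<in> {id, Transposition.transpose i j}"
          by (simp add: permutes_doubleton_iff)
        with \<sigma> show False by blast
      qed
      then obtain k where k: "k \<notin> {i, j}" "\<sigma> k \<noteq> k" by blast
      then have "A $ k $ \<sigma> k = 0" using A by auto
      then show "?t \<sigma> = 0" by (simp add: prod_zero_iff) blast
    qed
  qed simp
  also have "\<dots> = ?t id + ?t (Transposition.transpose i j)"
  proof (subst sum.insert)
    have "id i \<noteq> Transposition.transpose i j i" using ij by simp
    then show "id \<notin> {Transposition.transpose i j}" by fastforce
  qed simp_all
  also have "?t id = A $ i $ i * A $ j $ j"
    using A by (simp add: split)
  also have "?t (Transposition.transpose i j) = - (A $ i $ j * A $ j $ i)"
    using ij A by (simp add: split sign_swap_id transpose_def)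
  finally show ?thesis by simp
qed

section \<open>Determinants of even 2-adic forms\<close>

text \<open>On the active indices \<open>S\<close>, \<open>K\<close> is the Gram matrix of an even lattice over the 2-integral numbers
  and \<open>T = 2 K\<^sup>-\<^sup>1\<close> is even as well; both are the identity off \<open>S\<close>.\<close>

definition even_pair :: "'n set \<Rightarrow> real ^ 'n ^ 'n \<Rightarrow> real ^ 'n ^ 'n::finite \<Rightarrow> bool" where
  "even_pair S K T \<longleftrightarrow>
     (\<forall>i j. K $ i $ j = K $ j $ i \<and> T $ i $ j = T $ j $ i) \<and>
     (\<forall>i j. K $ i $ j \<in> p_integral 2 \<and> T $ i $ j \<in> p_integral 2) \<and>
     (\<forall>i\<in>S. K $ i $ i / 2 \<in> p_integral 2 \<and> T $ i $ i / 2 \<in> p_integral 2) \<and>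
     (\<forall>i j. i \<notin> S \<longrightarrow> K $ i $ j = (if i = j then 1 else 0) \<and> T $ i $ j = (if i = j then 1 else 0)) \<and>
     K ** T = (\<chi> i j. if i = j then if i \<in> S then 2 else 1 else 0)"

text \<open>The conditions are symmetric in the two matrices, so that a plane can be split off
  \<open>T\<close> when \<open>K\<close> has only even entries on \<open>S\<close>.\<close>

lemma even_pair_swap:
  assumes "even_pair S K T"
  shows "even_pair S T K"
proof -
  have "transpose K = K" "transpose T = T"
    using assms by (auto simp: even_pair_def transpose_def vec_eq_iff)
  then have "T ** K = transpose (K ** T)"
    by (simp add: matrix_transpose_mul)
  then have "T ** K = (\<chi> i j. if i = j then if i \<in> S then 2 else 1 else 0)"
    using assms by (auto simp: even_pair_def transpose_def vec_eq_iff)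
  then show ?thesis
    using assms by (auto simp: even_pair_def)
qed

text \<open>\<open>K'\<close> is the Schur complement of the plane spanned by the indices \<open>i\<close> and \<open>j\<close>; since its inverse
  is a submatrix of \<open>K\<^sup>-\<^sup>1\<close>, the matrix \<open>T'\<close> is merely the restriction of \<open>T\<close>.\<close>

lemma even_pair_split_plane:
  fixes K T :: "real ^ 'n ^ 'n::finite"
  assumes ep: "even_pair S K T" and ij: "i \<in> S" "j \<in> S" and odd: "K $ i $ j / 2 \<notin> p_integral 2"
  obtains K' T' \<delta> e where "i \<noteq> j" "even_pair (S - {i, j}) K' T'" "cong4 \<delta> (-1)" "cong4 e 1"
    "det K * e = \<delta> * det K'"
proof -
  have symK: "K $ a $ b = K $ b $ a" and symT: "T $ a $ b = T $ b $ a"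
    and intK: "K $ a $ b \<in> p_integral 2" and intT: "T $ a $ b \<in> p_integral 2"
    and offK: "a \<notin> S \<Longrightarrow> K $ a $ b = (if a = b then 1 else 0)"
    and offT: "a \<notin> S \<Longrightarrow> T $ a $ b = (if a = b then 1 else 0)" for a b
    using ep by (auto simp: even_pair_def)
  have evK: "K $ a $ a / 2 \<in> p_integral 2" and evT: "T $ a $ a / 2 \<in> p_integral 2" if "a \<in> S" for a
    using ep that by (auto simp: even_pair_def)
  have KT: "(\<Sum>c\<in>UNIV. K $ a $ c * T $ c $ b) = (if a = b then if a \<in> S then 2 else 1 else 0)" for a b
  proof -
    have "(K ** T) $ a $ b = (if a = b then if a \<in> S then 2 else 1 else 0)"
      using ep by (simp add: even_pair_def)
    then show ?thesis by (simp add: matrix_matrix_mult_def)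
  qed
  have ne: "i \<noteq> j" using odd evK[OF ij(1)] by auto
  define p q s where "p = K $ i $ i" and "q = K $ i $ j" and "s = K $ j $ j"
  have K: "K $ i $ i = p" "K $ i $ j = q" "K $ j $ i = q" "K $ j $ j = s"
    by (auto simp: p_def q_def s_def symK)
  have pqs: "p / 2 \<in> p_integral 2" "s / 2 \<in> p_integral 2" "q \<in> p_integral 2" "q / 2 \<notin> p_integral 2"
    using evK ij odd intK by (auto simp: p_def q_def s_def)
  define \<delta> where "\<delta> = p * s - q\<^sup>2"
  \<comment> \<open>Both diagonal entries are even, so their product is 0 modulo 4, while the odd
    \<open>q\<close> has square 1 modulo 4.\<close>
  have \<delta>: "cong4 \<delta> (-1)"
  proof -
    have "(\<delta> - (-1)) / 4 = (p / 2) * (s / 2) - (q\<^sup>2 - 1) / 4"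
      by (simp add: \<delta>_def field_simps)
    also have "\<dots> \<in> p_integral 2"
      using pqs p2_unit_cong4(1)[OF pqs(3,4)] by (intro p2_intros)
    finally show ?thesis .
  qed
  have \<delta>': "\<delta> \<noteq> 0" "1 / \<delta> \<in> p_integral 2"
    using cong4_unit[of \<delta> "-1"] \<delta> p2_unit_cong4(2)[of \<delta>] by (auto simp: p2_intros)
  define S' where "S' = S - {i, j}"
  have S': "a \<in> S" "a \<noteq> i" "a \<noteq> j" if "a \<in> S'" for a using that by (auto simp: S'_def)
  have notS': "i \<notin> S'" "j \<notin> S'" by (auto simp: S'_def)
  \<comment> \<open>\<open>u a\<close> and \<open>v a\<close> are the coordinates of the orthogonal
    projection of the \<open>a\<close>-th basis vector onto the plane, found by Cramer's rule; they
    are 2-integral because \<delta> is a unit.\<close>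
  define u where "u a = (if a \<in> S' then (K $ a $ i * s - K $ a $ j * q) / \<delta> else 0)" for a
  define v where "v a = (if a \<in> S' then (K $ a $ j * p - K $ a $ i * q) / \<delta> else 0)" for a
  have uv_int: "u a \<in> p_integral 2" "v a \<in> p_integral 2" for a
  proof -
    have "K $ a $ i * s - K $ a $ j * q \<in> p_integral 2" "K $ a $ j * p - K $ a $ i * q \<in> p_integral 2"
      using intK by (auto intro!: p2_intros simp: p_def q_def s_def)
    from this[THEN p_integral_mult[OF two_is_prime_nat _ \<delta>'(2)]]
    show "u a \<in> p_integral 2" "v a \<in> p_integral 2"
      by (auto simp: u_def v_def p2_intros)
  qed
  have uv: "u a * p + v a * q = K $ a $ i" "u a * q + v a * s = K $ a $ j" if "a \<in> S'" for a
  proof -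
    have uvd: "u a * \<delta> = K $ a $ i * s - K $ a $ j * q" "v a * \<delta> = K $ a $ j * p - K $ a $ i * q"
      using that \<delta>' by (simp_all add: u_def v_def)
    have "(u a * p + v a * q) * \<delta> = (u a * \<delta>) * p + (v a * \<delta>) * q"
      "(u a * q + v a * s) * \<delta> = (u a * \<delta>) * q + (v a * \<delta>) * s"
      by (simp_all add: algebra_simps)
    then have "(u a * p + v a * q) * \<delta> = K $ a $ i * \<delta>" "(u a * q + v a * s) * \<delta> = K $ a $ j * \<delta>"
      unfolding uvd by (simp_all add: \<delta>_def power2_eq_square algebra_simps)
    then show "u a * p + v a * q = K $ a $ i" "u a * q + v a * s = K $ a $ j"
      using \<delta>' by auto
  qed
  have uv0: "u a = 0" "v a = 0" if "a \<notin> S'" for a using that by (auto simp: u_def v_def)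
  \<comment> \<open>\<open>mat 1 + N\<close> subtracts these projections. Its square-zero part
    \<open>N\<close> feeds \<open>det_unipotent\<close>: only columns \<open>i\<close> and
    \<open>j\<close> are nonzero, and rows \<open>i\<close> and \<open>j\<close> vanish.\<close>
  define N :: "real ^ 'n ^ 'n" where "N = (\<chi> a b. if b = i then - u a else if b = j then - v a else 0)"
  have sum_ij: "(\<Sum>c\<in>UNIV. (if c = i then f c else if c = j then g c else 0)) = f i + g j" for f g :: "'n \<Rightarrow> real"
  proof -
    have "(if c = i then f c else if c = j then g c else 0) =
        (if c = i then f i else 0) + (if c = j then g j else 0)" for c
      using ne by auto
    then show ?thesis by (simp add: sum.distrib)
  qed
  have N_row: "(\<Sum>c\<in>UNIV. N $ a $ c * f c) = - u a * f i - v a * f j" for a and f :: "'n \<Rightarrow> real"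
  proof -
    have "N $ a $ c * f c = (if c = i then - u a * f c else if c = j then - v a * f c else 0)" for c
      by (auto simp: N_def)
    then show ?thesis by (simp add: sum_ij)
  qed
  have N_int: "N $ a $ b \<in> p_integral 2" for a b
    using uv_int by (auto simp: N_def intro: p2_intros)
  have NN: "N ** N = 0"
    using uv0 notS' by (simp add: vec_eq_iff matrix_matrix_mult_def N_row) (simp add: N_def)
  define L where "L a b = K $ a $ b - u a * K $ i $ b - v a * K $ j $ b" for a b
  have L0: "L a i = 0" "L a j = 0" if "a \<in> S'" for a
    using uv[OF that] by (simp_all add: L_def K algebra_simps)
  have L1: "L a b = K $ a $ b" if "a \<notin> S'" for a b
    using uv0[OF that] by (simp add: L_def)
  have mulE: "((mat 1 + N) ** K) $ a $ b = L a b" for a b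
  proof -
    have "((mat 1 + N) ** K) $ a $ b = (\<Sum>c\<in>UNIV. (if a = c then K $ c $ b else 0) + N $ a $ c * K $ c $ b)"
      by (simp add: matrix_matrix_mult_def mat_def) (rule sum.cong, auto simp: algebra_simps)
    also have "\<dots> = L a b"
      by (simp add: sum.distrib N_row L_def)
    finally show ?thesis .
  qed
  define B where "B = (mat 1 + N) ** K ** transpose (mat 1 + N)"
  have B: "B $ a $ b = L a b - u b * L a i - v b * L a j" for a b
  proof -
    have "B $ a $ b = (\<Sum>c\<in>UNIV. (if b = c then L a c else 0) + N $ b $ c * L a c)"
      unfolding B_def matrix_matrix_mult_def[of "(mat 1 + N) ** K"] vec_lambda_beta mulE
      by (rule sum.cong) (auto simp: transpose_def mat_def algebra_simps)
    also have "\<dots> = L a b - u b * L a i - v b * L a j"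
      by (simp add: sum.distrib N_row)
    finally show ?thesis .
  qed
  define A1 :: "real ^ 'n ^ 'n" where
    "A1 = (\<chi> a b. if a \<in> {i, j} then (if b \<in> {i, j} then K $ a $ b else 0) else if a = b then 1 else 0)"
  define K' :: "real ^ 'n ^ 'n" where
    "K' = (\<chi> a b. if a \<in> S' \<and> b \<in> S' then L a b else if a = b then 1 else 0)"
  define T' :: "real ^ 'n ^ 'n" where
    "T' = (\<chi> a b. if a \<in> S' \<and> b \<in> S' then T $ a $ b else if a = b then 1 else 0)"
  \<comment> \<open>The transformed Gram matrix is the orthogonal sum of the plane and its
    complement. Padding both blocks by the identity keeps the index type fixed and makes the sum a
    product.\<close>
  have "B = A1 ** K'"
  proof (simp add: vec_eq_iff, intro allI)
    fix a b
    have A1K: "(A1 ** K') $ a $ b = (if a \<in> {i, j} then (if b \<in> {i, j} then K $ a $ b else 0) else K' $ a $ b)"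
    proof (cases "a \<in> {i, j}")
      case True
      have "(A1 ** K') $ a $ b = (\<Sum>c\<in>UNIV. if c = i then K $ a $ c * K' $ c $ b else
          if c = j then K $ a $ c * K' $ c $ b else 0)"
        unfolding matrix_matrix_mult_def vec_lambda_beta
        by (rule sum.cong) (use True in \<open>auto simp: A1_def\<close>)
      also have "\<dots> = K $ a $ i * K' $ i $ b + K $ a $ j * K' $ j $ b"
        by (rule sum_ij)
      also have "\<dots> = (if b \<in> {i, j} then K $ a $ b else 0)"
        using notS' ne by (auto simp: K'_def)
      finally show ?thesis using True by simp
    next
      case False
      have "(A1 ** K') $ a $ b = (\<Sum>c\<in>UNIV. if a = c then K' $ c $ b else 0)"
        unfolding matrix_matrix_mult_def vec_lambda_beta
        by (rule sum.cong) (use False in \<open>auto simp: A1_def\<close>)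
      then show ?thesis using False by simp
    qed
    show "B $ a $ b = (A1 ** K') $ a $ b"
    proof (cases "a \<in> S'")
      case aS: True
      then have aij: "a \<notin> {i, j}" using S' by auto
      have Bab: "B $ a $ b = L a b" by (simp add: B L0[OF aS])
      show ?thesis
      proof (cases "b \<in> S'")
        case True
        then show ?thesis using aS aij Bab A1K by (simp add: K'_def)
      next
        case False
        have "L a b = 0"
        proof (cases "b \<in> {i, j}")
          case True
          then show ?thesis using L0[OF aS] by auto
        next
          case False
          with \<open>b \<notin> S'\<close> have "b \<notin> S" by (auto simp: S'_def)
          then have "K $ c $ b = (if b = c then 1 else 0)" for c using offK[of b c] symK by metis
          then show ?thesis using False \<open>b \<notin> S'\<close> aS by (auto simp: L_def)
        qed
        then show ?thesis using False aS aij Bab A1K by (auto simp: K'_def)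
      qed
    next
      case aS: False
      have Bab: "B $ a $ b = K $ a $ b - u b * K $ a $ i - v b * K $ a $ j"
        by (simp add: B L1[OF aS])
      show ?thesis
      proof (cases "a \<in> {i, j}")
        case True
        have "B $ a $ b = (if b \<in> {i, j} then K $ a $ b else 0)"
        proof (cases "b \<in> S'")
          case True
          then have "K $ b $ a = u b * K $ i $ a + v b * K $ j $ a"
            using uv[OF True] \<open>a \<in> {i, j}\<close> by (auto simp: K)
          moreover have "b \<notin> {i, j}" using True S' by auto
          ultimately show ?thesis using Bab symK[of a] by simp
        next
          case False
          have "b \<notin> {i, j} \<Longrightarrow> K $ a $ b = 0"
            using False \<open>a \<in> {i, j}\<close> offK[of b a] symK[of a b] by (auto simp: S'_def)
          then show ?thesis using Bab uv0[OF False] by simp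
        qed
        then show ?thesis using True A1K by simp
      next
        case False
        then have "a \<notin> S" using aS by (auto simp: S'_def)
        then have "B $ a $ b = (if a = b then 1 else 0)"
          using Bab offK False by auto
        then show ?thesis using A1K False aS by (simp add: K'_def)
      qed
    qed
  qed
  moreover have "det A1 = \<delta>"
    using ne by (subst det_plane[OF ne]) (auto simp: A1_def K \<delta>_def power2_eq_square)
  moreover have "det B = (det (mat 1 + N))\<^sup>2 * det K"
    by (simp add: B_def det_mul power2_eq_square)
  ultimately have det: "det K * (det (mat 1 + N))\<^sup>2 = \<delta> * det K'"
    by (simp add: det_mul mult.commute)
  have "even_pair S' K' T'"
    unfolding even_pair_def
  proof (intro conjI allI ballI impI)
    fix a b
    show "K' $ a $ b = K' $ b $ a"
    proof (cases "a \<in> S' \<and> b \<in> S'")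
      case True
      have "L a b = L b a"
      proof -
        have "u a * K $ b $ i + v a * K $ b $ j = u b * K $ a $ i + v b * K $ a $ j"
          using uv[of a] uv[of b] True by (simp add: algebra_simps flip: uv)
        then show ?thesis
          by (simp add: L_def symK[of i] symK[of j] symK[of a b])
      qed
      then show ?thesis using True by (simp add: K'_def)
    qed (auto simp: K'_def)
    show "T' $ a $ b = T' $ b $ a"
      by (auto simp: T'_def symT)
    have "L a b \<in> p_integral 2"
      unfolding L_def by (intro p2_intros intK uv_int)
    then show "K' $ a $ b \<in> p_integral 2"
      by (auto simp: K'_def p2_intros)
    show "T' $ a $ b \<in> p_integral 2"
      using intT by (auto simp: T'_def p2_intros)
  next
    fix a assume a: "a \<in> S'"
    have "u a * K $ i $ a + v a * K $ j $ a = u a * (u a * p + v a * q) + v a * (u a * q + v a * s)"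
      using uv[OF a] by (simp add: symK)
    \<comment> \<open>Evenness survives: the norm of the subtracted projection is
      \<open>u\<^sup>2 p + 2 u v q + v\<^sup>2 s\<close>, with \<open>p\<close> and \<open>s\<close>
      even.\<close>
    then have "L a a / 2 = K $ a $ a / 2 - (u a)\<^sup>2 * (p / 2) - (v a)\<^sup>2 * (s / 2) - u a * v a * q"
      by (simp add: L_def power2_eq_square field_simps)
    also have "\<dots> \<in> p_integral 2"
      by (intro p2_intros uv_int pqs evK S'(1) a)
    finally show "K' $ a $ a / 2 \<in> p_integral 2"
      using a by (simp add: K'_def)
    show "T' $ a $ a / 2 \<in> p_integral 2"
      using a evT S' by (simp add: T'_def)
  next
    fix a b assume "a \<notin> S'"
    then show "K' $ a $ b = (if a = b then 1 else 0)" "T' $ a $ b = (if a = b then 1 else 0)"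
      by (auto simp: K'_def T'_def)
  next
    show "K' ** T' = (\<chi> a b. if a = b then if a \<in> S' then 2 else 1 else 0)"
    proof -
      have "(K' ** T') $ a $ b = (if a = b then if a \<in> S' then 2 else 1 else 0)" for a b
      proof (cases "a \<in> S' \<and> b \<in> S'")
        case True
        \<comment> \<open>The sum may run over all indices: \<open>L a c\<close> vanishes at
          \<open>i\<close> and \<open>j\<close>, and \<open>T $ c $ b\<close> vanishes for
          \<open>c\<close> outside \<open>S\<close>.\<close>
        have "(K' ** T') $ a $ b = (\<Sum>c\<in>UNIV. L a c * T $ c $ b)"
          unfolding matrix_matrix_mult_def vec_lambda_beta
        proof (rule sum.cong[OF refl])
          fix c
          show "K' $ a $ c * T' $ c $ b = L a c * T $ c $ b"
          proof (cases "c \<in> S'")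
            case True
            with \<open>a \<in> S' \<and> b \<in> S'\<close> show ?thesis by (simp add: K'_def T'_def)
          next
            case False
            then have "c \<notin> S \<or> c = i \<or> c = j" by (auto simp: S'_def)
            then have "L a c * T $ c $ b = 0"
            proof (elim disjE)
              assume "c \<notin> S"
              then have "T $ c $ b = 0" using offT[of c b] \<open>a \<in> S' \<and> b \<in> S'\<close> S' by auto
              then show ?thesis by simp
            qed (use L0 \<open>a \<in> S' \<and> b \<in> S'\<close> in auto)
            with False \<open>a \<in> S' \<and> b \<in> S'\<close> show ?thesis by (auto simp: K'_def)
          qed
        qed
        also have "\<dots> = (\<Sum>c\<in>UNIV. K $ a $ c * T $ c $ b) - u a * (\<Sum>c\<in>UNIV. K $ i $ c * T $ c $ b)
            - v a * (\<Sum>c\<in>UNIV. K $ j $ c * T $ c $ b)"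
          by (simp add: L_def sum_distrib_left algebra_simps sum_subtractf sum.distrib)
        \<comment> \<open>The two correction sums are entries of \<open>K ** T\<close> in rows
          \<open>i\<close> and \<open>j\<close>, hence off the diagonal, as \<open>b\<close> is
          neither index.\<close>
        also have "\<dots> = (if a = b then if a \<in> S' then 2 else 1 else 0)"
          unfolding KT using True S' by auto
        finally show ?thesis .
      next
        case False
        have "K' $ a $ c * T' $ c $ b = (if a = c then (if a = b then 1 else 0) else 0)" for c
        proof (cases "a \<in> S'")
          case True
          then have "b \<notin> S'" "a \<noteq> b" using False by auto
          then show ?thesis by (cases "c = b") (simp_all add: K'_def T'_def)
        next
          case False
          then show ?thesis by (cases "a = c") (simp_all add: K'_def T'_def)
        qed
        then have "(K' ** T') $ a $ b = (if a = b then 1 else 0)"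
          by (simp add: matrix_matrix_mult_def)
        then show ?thesis using False by auto
      qed
      then show ?thesis by (simp add: vec_eq_iff)
    qed
  qed
  then show ?thesis
    using that[of K' T' \<delta> "(det (mat 1 + N))\<^sup>2"] ne \<delta> det det_unipotent(1)[OF N_int NN]
    by (simp add: S'_def)
qed

text \<open>Each plane with an odd off-diagonal entry contributes -1 modulo 4 and lowers the rank by
  2. If only \<open>T\<close> has such an entry, \<open>T\<close> is split instead and
  \<open>det K * det T = 2 ^ card S\<close> transfers the result; as the rank is even, this costs
  only a power of 4.\<close>

lemma even_pair_det:
  fixes K T :: "real ^ 'n ^ 'n::finite"
  assumes "even_pair S K T"
  shows "even (card S) \<and> (\<exists>k w. det K = 4 powi k * w \<and> cong4 w ((-1) ^ (card S div 2)))"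
  using assms
proof (induction "card S" arbitrary: S K T rule: less_induct)
  case less
  \<comment> \<open>Stated for arbitrary matrices so that it applies to the swapped pair as
    well.\<close>
  have split: "even (card S) \<and> (\<exists>k w. det K = 4 powi k * w \<and> cong4 w ((-1) ^ (card S div 2)))"
    if ep: "even_pair S K T" and ij: "i \<in> S" "j \<in> S" "K $ i $ j / 2 \<notin> p_integral 2"
    for K T :: "real ^ 'n ^ 'n" and i j
  proof -
    obtain K' T' \<delta> e where *: "i \<noteq> j" "even_pair (S - {i, j}) K' T'" "cong4 \<delta> (-1)" "cong4 e 1"
      "det K * e = \<delta> * det K'"
      using even_pair_split_plane[OF ep ij] by metis
    have card: "card S = card (S - {i, j}) + 2"
      using ij * by (simp add: card_Diff_subset)
        (metis One_nat_def Suc_1 add_2_eq_Suc' card_2_iff card_mono empty_subsetI finite insert_subset le_add_diff_inverse2)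
    then obtain k w where w: "det K' = 4 powi k * w" "cong4 w ((-1) ^ (card (S - {i, j}) div 2))"
      and ev: "even (card (S - {i, j}))"
      using less(1)[OF _ *(2)] by auto
    have e: "e \<noteq> 0" "cong4 (1 / e) 1"
      using cong4_inverse[of e 1] cong4_unit[of e 1] * by (auto simp: p2_intros)
    have "cong4 (\<delta> * w * (1 / e)) ((-1) ^ (card S div 2))"
      using cong4_mult[OF cong4_mult[of \<delta> "-1" w "(-1) ^ (card (S - {i, j}) div 2)"], of "1 / e" 1]
        * w e by (simp add: card)
    moreover have "det K = 4 powi k * (\<delta> * w * (1 / e))"
      using *(5) e w by (simp add: field_simps)
    moreover have "even (card S)" using ev card by simp
    ultimately show ?thesis by blast
  qed
  consider "S = {}" | i j where "i \<in> S" "j \<in> S" "K $ i $ j / 2 \<notin> p_integral 2"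
    | i j where "i \<in> S" "j \<in> S" "T $ i $ j / 2 \<notin> p_integral 2"
    | i where "i \<in> S" "\<forall>i\<in>S. \<forall>j\<in>S. K $ i $ j / 2 \<in> p_integral 2" "\<forall>i\<in>S. \<forall>j\<in>S. T $ i $ j / 2 \<in> p_integral 2"
    by blast
  then show ?case
  proof cases
    case 1
    then have "K = mat 1" using less(2) by (simp add: even_pair_def mat_def vec_eq_iff)
    then show ?thesis using 1
      by (intro conjI exI[of _ 0] exI[of _ 1]) (auto simp: p2_intros)
  next
    case 2
    then show ?thesis using split less(2) by blast
  next
    case 3
    then have "even (card S) \<and> (\<exists>k w. det T = 4 powi k * w \<and> cong4 w ((-1) ^ (card S div 2)))"
      using split even_pair_swap[OF less(2)] by blast
    then obtain k w where w: "even (card S)" "det T = 4 powi k * w" "cong4 w ((-1) ^ (card S div 2))"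
      by blast
    define h where "h = card S div 2"
    have h: "(-1) ^ h = (1 :: int) \<or> (-1) ^ h = (-1 :: int)"
      by (metis minus_one_power_iff)
    have w': "cong4 w (of_int ((-1) ^ h))" using w by (simp add: h_def)
    have "odd ((-1) ^ h :: int)" by simp
    then have "w \<noteq> 0" using cong4_unit(2)[OF w'] by (auto simp: p2_intros)
    have "cong4 (1 / w) ((-1) ^ (card S div 2))"
      using cong4_inverse[OF w' h] by (simp add: h_def)
    have "det K * det T = det (K ** T)" by (simp add: det_mul)
    also have "\<dots> = (\<Prod>i\<in>UNIV. if i \<in> S then 2 else 1)"
      using less(2) by (subst det_diagonal) (auto simp: even_pair_def)
    also have "\<dots> = 2 ^ card S"
      by (simp add: prod.If_cases)
    also have "\<dots> = 4 powi int h"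
    proof -
      have "card S = 2 * h" using w(1) by (simp add: h_def)
      then show ?thesis by (simp add: power_mult)
    qed
    finally have "det K = 4 powi int h / (4 powi k * w)"
      using w(2) \<open>w \<noteq> 0\<close> by (simp add: field_simps)
    also have "\<dots> = 4 powi (int h - k) * (1 / w)"
      by (simp add: power_int_diff)
    finally show ?thesis using w(1) \<open>cong4 (1 / w) _\<close> by blast
  next
    \<comment> \<open>If all entries of both matrices on \<open>S\<close> were even, each diagonal
      entry of \<open>K ** T\<close> there would be divisible by 4, but it is 2.\<close>
    case 4
    have "(K ** T) $ i $ i = 2" using less(2) 4 by (simp add: even_pair_def)
    then have "(\<Sum>c\<in>UNIV. K $ i $ c * T $ c $ i) = 2" by (simp add: matrix_matrix_mult_def)
    moreover have "K $ i $ c * T $ c $ i / 4 \<in> p_integral 2" for c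
    proof (cases "c \<in> S")
      case True
      then have "(K $ i $ c / 2) * (T $ c $ i / 2) \<in> p_integral 2"
        using 4 by (intro p2_intros) auto
      then show ?thesis by simp
    next
      case False
      then have "T $ c $ i = 0" using less(2) 4 by (auto simp: even_pair_def)
      then show ?thesis by (simp add: p2_intros)
    qed
    then have "(\<Sum>c\<in>UNIV. K $ i $ c * T $ c $ i / 4) \<in> p_integral 2"
      by (intro p_integral_sum) auto
    ultimately have "1 / 2 \<in> p_integral 2"
      by (simp flip: sum_divide_distrib)
    then show ?thesis using half_not_p2 by simp
  qed
qed

section \<open>Arithmetic of the lattice generated by a design\<close>

lemma matrix_mult_transpose_nth:
  fixes A B :: "real ^ 'n ^ 'm"
  shows "(A ** transpose B) $ i $ j = A $ i \<bullet> B $ j"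
  by (simp add: matrix_matrix_mult_def transpose_def inner_vec_def)

lemma dvd_four_consecutive: "24 dvd (k - 1) * k * (k + 1) * (k + 2)" for k :: int
proof -
  have "3 dvd k - 1 \<or> 3 dvd k \<or> 3 dvd k + 1" by presburger
  then have 3: "3 dvd (k - 1) * k * (k + 1) * (k + 2)" by (auto intro: dvd_mult dvd_mult2)
  have "(4 dvd k - 1 \<and> 2 dvd k + 1) \<or> (4 dvd k \<and> 2 dvd k + 2) \<or> (2 dvd k - 1 \<and> 4 dvd k + 1)
      \<or> (2 dvd k \<and> 4 dvd k + 2)"
    by presburger
  then have "4 * 2 dvd (k - 1) * (k + 1) \<or> 4 * 2 dvd k * (k + 2) \<or> 2 * 4 dvd (k - 1) * (k + 1) \<or>
      2 * 4 dvd k * (k + 2)"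
    by (meson mult_dvd_mono)
  then have "8 dvd (k - 1) * (k + 1) * (k * (k + 2))"
    by (auto intro: dvd_mult dvd_mult2)
  then have "8 dvd (k - 1) * k * (k + 1) * (k + 2)" by (simp add: mult_ac)
  moreover have "24 dvd x" if "3 dvd x" "8 dvd x" for x :: int
    using that by presburger
  ultimately show ?thesis using 3 by blast
qed

text \<open>At \<open>t = 2 k + 1\<close> the value is 16 times a product of four consecutive
  integers, so \<open>384 = 16 * 24\<close>.\<close>

lemma dvd_odd_quartic: "odd t \<Longrightarrow> 384 dvd (t\<^sup>2 - 1) * (t\<^sup>2 - 9)" for t :: int
proof -
  assume "odd t"
  then obtain k where t: "t = 2 * k + 1" by (elim oddE)
  have "(t\<^sup>2 - 1) * (t\<^sup>2 - 9) = 16 * ((k - 1) * k * (k + 1) * (k + 2))"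
    by (simp add: t power2_eq_square algebra_simps)
  moreover have "16 * 24 dvd 16 * ((k - 1) * k * (k + 1) * (k + 2))"
    by (intro mult_dvd_mono dvd_four_consecutive) simp
  ultimately show ?thesis by simp
qed

lemma dvd_quartic: "12 dvd t\<^sup>2 * (t\<^sup>2 - 1)" for t :: int
proof -
  have eq: "t\<^sup>2 * (t\<^sup>2 - 1) = (t - 1) * (t + 1) * (t * t)"
    by (simp add: power2_eq_square algebra_simps)
  have "3 dvd t - 1 \<or> 3 dvd t \<or> 3 dvd t + 1" by presburger
  then have 3: "3 dvd (t - 1) * (t + 1) * (t * t)" by (auto intro: dvd_mult dvd_mult2)
  have "(2 dvd t \<and> 2 dvd t) \<or> (2 dvd t - 1 \<and> 2 dvd t + 1)" by presburger
  then have "2 * 2 dvd t * t \<or> 2 * 2 dvd (t - 1) * (t + 1)"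
    by (meson mult_dvd_mono)
  then have "4 dvd (t - 1) * (t + 1) * (t * t)" by (auto intro: dvd_mult dvd_mult2)
  moreover have "12 dvd x" if "3 dvd x" "4 dvd x" for x :: int
    using that by presburger
  ultimately show ?thesis using 3 unfolding eq by blast
qed

text \<open>A tight spherical 5-design rescaled to norm \<open>2 m + 1\<close>, which makes its inner products \<open>\<plusminus>1\<close>.\<close>

locale scaled_tight_design =
  fixes Z :: "(real ^ 'n::finite) set" and m :: nat
  assumes m_pos: "m > 0" and finite_Z: "finite Z" and Z_nonempty: "Z \<noteq> {}"
    and inner_self: "z \<in> Z \<Longrightarrow> z \<bullet> z = 2 * real m + 1"
    and inner_distinct: "z \<in> Z \<Longrightarrow> w \<in> Z \<Longrightarrow> w \<noteq> z \<Longrightarrow> w \<noteq> - z \<Longrightarrow> \<bar>z \<bullet> w\<bar> = 1"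
    and minus_mem: "z \<in> Z \<Longrightarrow> - z \<in> Z"
    and card_Z: "real (card Z) = 4 * real (m * (m + 1)) * ((2 * real m + 1)\<^sup>2 - 2)"
    and moment_2: "(\<Sum>z\<in>Z. (z \<bullet> a)\<^sup>2) = 4 * real (m * (m + 1)) * (2 * real m + 1) * (a \<bullet> a)"
    and moment_4: "(\<Sum>z\<in>Z. (z \<bullet> a) ^ 4) = 12 * real (m * (m + 1)) * (a \<bullet> a)\<^sup>2"
begin

lemma moment_2_factor_pos: "0 < 4 * real (m * (m + 1)) * (2 * real m + 1)"
proof -
  have "0 < m * (m + 1)" using m_pos by simp
  then have "0 < real (m * (m + 1))" by (simp only: of_nat_0_less_iff)
  then show ?thesis by (intro mult_pos_pos) auto
qed

lemma inner_odd:
  assumes "z \<in> Z" "w \<in> Z"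
  obtains k :: int where "odd k" "z \<bullet> w = of_int k"
proof (cases "w = z \<or> w = - z")
  case True
  then have "z \<bullet> w = of_int (2 * int m + 1) \<or> z \<bullet> w = of_int (- (2 * int m + 1))"
    using inner_self[OF assms(1)] by auto
  then show ?thesis using that by (metis even_plus_one_iff even_mult_iff even_minus even_numeral)
next
  case False
  then have "z \<bullet> w = of_int 1 \<or> z \<bullet> w = of_int (- 1)"
    using inner_distinct[OF assms] by auto
  then show ?thesis using that by (metis odd_one even_minus)
qed

lemma inner_Ints: "z \<in> Z \<Longrightarrow> w \<in> Z \<Longrightarrow> z \<bullet> w \<in> \<int>"
  by (metis inner_odd Ints_of_int)

text \<open>Even functions contribute equally at \<open>z\<close> and \<open>-z\<close>, which doubles the divisibility.\<close>

lemma even_sum_multiple: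
  fixes h :: "real \<Rightarrow> real" and c :: int
  assumes even: "\<And>t. h (- t) = h t" and int: "\<And>z. z \<in> Z \<Longrightarrow> \<exists>i :: int. h (z \<bullet> a) = of_int (c * i)"
  shows "\<exists>i :: int. (\<Sum>z\<in>Z. h (z \<bullet> a)) = of_int (2 * c * i)"
proof -
  obtain z0 where z0: "z0 \<in> Z" using Z_nonempty by blast
  have nz: "z \<bullet> z0 \<noteq> 0" if z: "z \<in> Z" for z
  proof -
    obtain k :: int where "odd k" "z \<bullet> z0 = of_int k" using inner_odd[OF z z0] .
    then show ?thesis by auto
  qed
  \<comment> \<open>Inner products with \<open>z0\<close> are odd, hence nonzero, so their sign
    picks exactly one of \<open>z\<close> and \<open>- z\<close>.\<close>
  define X where "X = {z \<in> Z. z \<bullet> z0 > 0}"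
  have fin: "finite X" using finite_Z by (simp add: X_def)
  have Z: "Z = X \<union> uminus ` X"
  proof
    show "Z \<subseteq> X \<union> uminus ` X"
    proof
      fix z assume z: "z \<in> Z"
      show "z \<in> X \<union> uminus ` X"
      proof (cases "z \<bullet> z0 > 0")
        case False
        then have "- z \<in> X" using nz[OF z] minus_mem[OF z] by (simp add: X_def)
        then have "- (- z) \<in> uminus ` X" by (rule imageI)
        then show ?thesis by simp
      qed (use z in \<open>simp add: X_def\<close>)
    qed
  qed (use minus_mem in \<open>auto simp: X_def\<close>)
  have disj: "X \<inter> uminus ` X = {}" by (auto simp: X_def)
  have "(\<Sum>z\<in>Z. h (z \<bullet> a)) = (\<Sum>z\<in>X. h (z \<bullet> a)) + (\<Sum>z\<in>uminus ` X. h (z \<bullet> a))"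
    by (subst Z, rule sum.union_disjoint) (use fin disj in auto)
  also have "(\<Sum>z\<in>uminus ` X. h (z \<bullet> a)) = (\<Sum>z\<in>X. h (z \<bullet> a))"
    by (subst sum.reindex) (auto simp: even)
  finally have "(\<Sum>z\<in>Z. h (z \<bullet> a)) = 2 * (\<Sum>z\<in>X. h (z \<bullet> a))" by simp
  moreover obtain i where "\<And>z. z \<in> X \<Longrightarrow> h (z \<bullet> a) = of_int (c * i z)"
    using int unfolding X_def by (metis (no_types, lifting) mem_Collect_eq)
  then have "(\<Sum>z\<in>X. h (z \<bullet> a)) = of_int (c * (\<Sum>z\<in>X. i z))"
    by (simp add: sum_distrib_left)
  ultimately show ?thesis
    by (intro exI[of _ "\<Sum>z\<in>X. i z"]) simp
qed

section \<open>Norms of dual vectors\<close>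

text \<open>The sum of \<open>t\<^sup>2 * (t\<^sup>2 - 1)\<close> over \<open>Z\<close> is the
  fourth moment minus the second. Its terms are divisible by 12, the symmetry doubles this to 24,
  and the factor 4 of the moments cancels, leaving 6.\<close>

lemma norm_integral_condition:
  assumes "\<And>z. z \<in> Z \<Longrightarrow> z \<bullet> a \<in> \<int>"
  shows "\<exists>k :: int. real (m * (m + 1)) * (a \<bullet> a) * (3 * (a \<bullet> a) - (2 * real m + 1)) = of_int (6 * k)"
proof -
  define h :: "real \<Rightarrow> real" where "h t = t\<^sup>2 * (t\<^sup>2 - 1)" for t
  have "\<exists>i :: int. (\<Sum>z\<in>Z. h (z \<bullet> a)) = of_int (2 * 12 * i)"
  proof (rule even_sum_multiple)
    fix z assume "z \<in> Z"
    with assms obtain t :: int where t: "z \<bullet> a = of_int t" by (metis Ints_cases)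
    from dvd_quartic[of t] obtain i where "t\<^sup>2 * (t\<^sup>2 - 1) = 12 * i" by blast
    then have "(of_int (t\<^sup>2 * (t\<^sup>2 - 1)) :: real) = of_int (12 * i)" by simp
    then show "\<exists>i :: int. h (z \<bullet> a) = of_int (12 * i)"
      by (intro exI[of _ i]) (simp add: h_def t)
  qed (simp add: h_def)
  then obtain i :: int where i: "(\<Sum>z\<in>Z. h (z \<bullet> a)) = of_int (24 * i)" by auto
  have "(\<Sum>z\<in>Z. h (z \<bullet> a)) = (\<Sum>z\<in>Z. (z \<bullet> a) ^ 4) - (\<Sum>z\<in>Z. (z \<bullet> a)\<^sup>2)"
    unfolding sum_subtractf[symmetric]
    by (rule sum.cong) (auto simp: h_def algebra_simps simp flip: power_add)
  then show ?thesis
    using i unfolding moment_2 moment_4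
    by (intro exI[of _ i]) (simp add: power2_eq_square algebra_simps)
qed

text \<open>For odd \<open>t\<close> the roots 1, -1, 3, -3 give a quartic far more divisible by 2.
  Doubling 384 and cancelling 4 leaves 192; the constant term 9 brings in
  \<open>card Z\<close>.\<close>

lemma norm_odd_condition:
  assumes "\<And>z. z \<in> Z \<Longrightarrow> \<exists>k :: int. odd k \<and> z \<bullet> a = of_int k"
  shows "\<exists>k :: int. real (m * (m + 1)) *
    (3 * (a \<bullet> a)\<^sup>2 - 10 * (2 * real m + 1) * (a \<bullet> a) + 9 * (2 * real m + 1)\<^sup>2 - 18) = of_int (192 * k)"
proof -
  define h :: "real \<Rightarrow> real" where "h t = (t\<^sup>2 - 1) * (t\<^sup>2 - 9)" for t
  have "\<exists>i :: int. (\<Sum>z\<in>Z. h (z \<bullet> a)) = of_int (2 * 384 * i)"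
  proof (rule even_sum_multiple)
    fix z assume "z \<in> Z"
    with assms obtain t :: int where t: "odd t" "z \<bullet> a = of_int t" by metis
    from dvd_odd_quartic[OF t(1)] obtain i where "(t\<^sup>2 - 1) * (t\<^sup>2 - 9) = 384 * i" by blast
    then have "(of_int ((t\<^sup>2 - 1) * (t\<^sup>2 - 9)) :: real) = of_int (384 * i)" by simp
    then show "\<exists>i :: int. h (z \<bullet> a) = of_int (384 * i)"
      by (intro exI[of _ i]) (simp add: h_def t)
  qed (simp add: h_def)
  then obtain i :: int where i: "(\<Sum>z\<in>Z. h (z \<bullet> a)) = of_int (768 * i)" by auto
  have "(\<Sum>z\<in>Z. h (z \<bullet> a)) = (\<Sum>z\<in>Z. (z \<bullet> a) ^ 4 - 10 * (z \<bullet> a)\<^sup>2 + 9)"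
    by (rule sum.cong) (auto simp: h_def algebra_simps simp flip: power_add)
  also have "\<dots> = (\<Sum>z\<in>Z. (z \<bullet> a) ^ 4) - 10 * (\<Sum>z\<in>Z. (z \<bullet> a)\<^sup>2) + 9 * real (card Z)"
    by (simp add: sum.distrib sum_subtractf sum_distrib_left)
  finally have "4 * (real (m * (m + 1)) *
    (3 * (a \<bullet> a)\<^sup>2 - 10 * (2 * real m + 1) * (a \<bullet> a) + 9 * (2 * real m + 1)\<^sup>2 - 18)) = of_int (768 * i)"
    unfolding i moment_2 moment_4 card_Z by (simp add: algebra_simps)
  then show ?thesis
    by (intro exI[of _ i]) simp
qed

lemma norm_rational:
  assumes "\<And>z. z \<in> Z \<Longrightarrow> z \<bullet> a \<in> \<int>"
  obtains x y :: int where "y > 0" "coprime x y" "a \<bullet> a = of_int x / of_int y"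
proof -
  have "(\<Sum>z\<in>Z. (z \<bullet> a)\<^sup>2) \<in> \<int>"
    using assms by (intro Ints_sum Ints_power)
  then have "(\<Sum>z\<in>Z. (z \<bullet> a)\<^sup>2) \<in> \<rat>"
    using Ints_subset_Rats by blast
  moreover have "a \<bullet> a = (\<Sum>z\<in>Z. (z \<bullet> a)\<^sup>2) / (4 * real (m * (m + 1)) * (2 * real m + 1))"
    using moment_2_factor_pos unfolding moment_2 by (subst nonzero_mult_div_cancel_left) auto
  moreover have "4 * real (m * (m + 1)) * (2 * real m + 1) \<in> \<rat>"
    by (intro Rats_mult Rats_add) auto
  ultimately have "a \<bullet> a \<in> \<rat>" by (metis Rats_divide)
  then show ?thesis using that by (rule Rats_cases')
qed

text \<open>Write the norm in lowest terms as \<open>x / y\<close>, with \<open>p\<close> dividing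
  \<open>y\<close>. For \<open>p \<ge> 5\<close> both \<open>x\<close> and
  \<open>3 * x - d * y\<close> are prime to \<open>p\<close>, so \<open>p\<^sup>2\<close> divides
  \<open>M * x * (3 * x - d * y) = 6 * k * y\<^sup>2\<close> only through \<open>M\<close>.\<close>

lemma norm_p_integral:
  assumes p: "prime p" "(p = 3 \<and> [m = 1] (mod 3)) \<or> (p \<ge> 5 \<and> \<not> p\<^sup>2 dvd m * (m + 1))"
    and a: "\<And>z. z \<in> Z \<Longrightarrow> z \<bullet> a \<in> p_integral p"
  shows "a \<bullet> a \<in> p_integral p"
proof -
  obtain s :: int where s: "\<not> int p dvd s" "\<And>z. z \<in> Z \<Longrightarrow> of_int s * (z \<bullet> a) \<in> \<int>"
    using p_integral_common_denominator[OF p(1) finite_Z, of "\<lambda>z. z \<bullet> a"] a by metis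
  define b where "b = of_int s *\<^sub>R a"
  have b: "z \<bullet> b \<in> \<int>" if "z \<in> Z" for z
    using s(2)[OF that] by (simp add: b_def)
  obtain x y :: int where xy: "y > 0" "coprime x y" "b \<bullet> b = of_int x / of_int y"
    using norm_rational[OF b] by metis
  define M d where "M = int (m * (m + 1))" and "d = 2 * int m + 1"
  obtain k :: int where "real_of_int M * (b \<bullet> b) * (3 * (b \<bullet> b) - real_of_int d) = of_int (6 * k)"
    using norm_integral_condition[OF b] by (auto simp: M_def d_def)
  then have "real_of_int (M * x * (3 * x - d * y)) = of_int (6 * k * y\<^sup>2)"
    using xy(1) unfolding xy(3) by (simp add: field_simps power2_eq_square)
  then have k: "M * x * (3 * x - d * y) = 6 * k * y\<^sup>2"
    by (simp only: of_int_eq_iff)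
  have pp: "prime (int p)" using p(1) by simp
  have "\<not> int p dvd y"
  proof
    assume y: "int p dvd y"
    then have x: "\<not> int p dvd x"
      using xy(2) pp by (meson coprime_common_divisor not_prime_unit)
    from p(2) show False
    proof
      \<comment> \<open>Here 3 divides \<open>d\<close>, so a factor 3 cancels on both sides and the
        remaining linear factor is prime to 3. Then 3 would divide \<open>M\<close>, which is 2
        modulo 3.\<close>
      assume p3: "p = 3 \<and> [m = 1] (mod 3)"
      then have "m mod 3 = 1" by (simp add: cong_def)
      then obtain q where q: "m = 3 * q + 1" by (metis mult_div_mod_eq)
      have "M * x * (x - (2 * int q + 1) * y) = 2 * k * y\<^sup>2"
        using k by (simp add: d_def q algebra_simps)
      moreover have "3 dvd 2 * k * y\<^sup>2" using y p3 by (simp add: power2_eq_square)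
      ultimately have "3 dvd M * x * (x - (2 * int q + 1) * y)" by simp
      moreover have "prime (3 :: int)" using pp p3 by simp
      moreover have "\<not> 3 dvd x - (2 * int q + 1) * y"
        using x y p3 by (simp add: dvd_diff_left_iff)
      ultimately have "3 dvd M" using x p3 by (auto simp: prime_dvd_mult_iff)
      moreover have "M = 3 * (3 * int q * int q + 3 * int q) + 2"
        by (simp add: M_def q algebra_simps)
      ultimately show False by presburger
    next
      assume p5: "p \<ge> 5 \<and> \<not> p\<^sup>2 dvd m * (m + 1)"
      have "\<not> int p dvd 3"
        using p5 by (auto dest!: zdvd_imp_le)
      then have "\<not> int p dvd 3 * x - d * y"
        using x y pp by (simp add: dvd_diff_left_iff prime_dvd_mult_iff)
      then have "coprime (int p) (x * (3 * x - d * y))"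
        using x pp by (intro prime_imp_coprime) (auto simp: prime_dvd_mult_iff)
      then have cop: "coprime ((int p)\<^sup>2) (x * (3 * x - d * y))" by simp
      have "(int p)\<^sup>2 dvd y\<^sup>2" using y by simp
      then have "(int p)\<^sup>2 dvd M * x * (3 * x - d * y)" unfolding k by simp
      then have "(int p)\<^sup>2 dvd M * (x * (3 * x - d * y))" by (simp only: mult.assoc)
      then have "(int p)\<^sup>2 dvd M"
        using cop by (simp only: coprime_dvd_mult_left_iff)
      then have "int (p\<^sup>2) dvd int (m * (m + 1))" by (simp only: M_def of_nat_power)
      then have "p\<^sup>2 dvd m * (m + 1)" by (simp only: int_dvd_int_iff)
      with p5 show False by blast
    qed
  qed
  then have "b \<bullet> b \<in> p_integral p"
    using xy(3) by (rule p_integralI)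
  moreover have "b \<bullet> b = of_int (s\<^sup>2) * (a \<bullet> a)" by (simp add: b_def power2_eq_square)
  moreover have "s \<noteq> 0" using s(1) by auto
  moreover have "\<not> int p dvd s\<^sup>2" using s(1) pp by (simp add: prime_dvd_power_iff)
  ultimately show ?thesis
    using p_integral_divide_of_int[OF p(1), of "b \<bullet> b" "s\<^sup>2"] by simp
qed

text \<open>Polarization, with 2 invertible at \<open>p\<close>. It says that the dual lattice is
  integral at \<open>p\<close>, which is what makes the lattice unimodular there.\<close>

lemma inner_p_integral:
  assumes p: "prime p" "(p = 3 \<and> [m = 1] (mod 3)) \<or> (p \<ge> 5 \<and> \<not> p\<^sup>2 dvd m * (m + 1))"
    and a: "\<And>z. z \<in> Z \<Longrightarrow> z \<bullet> a \<in> p_integral p" and b: "\<And>z. z \<in> Z \<Longrightarrow> z \<bullet> b \<in> p_integral p"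
  shows "a \<bullet> b \<in> p_integral p"
proof -
  note norm = norm_p_integral[OF p]
  have "(a + b) \<bullet> (a + b) - a \<bullet> a - b \<bullet> b \<in> p_integral p"
    by (intro p_integral_diff[OF p(1)] norm) (auto simp: inner_add_right intro: a b p_integral_add[OF p(1)])
  moreover have "(a + b) \<bullet> (a + b) - a \<bullet> a - b \<bullet> b = 2 * (a \<bullet> b)"
    by (simp add: inner_add_left inner_add_right inner_commute)
  moreover have "\<not> int p dvd 2" using p(2) by (auto dest!: zdvd_imp_le)
  ultimately show ?thesis
    using p_integral_divide_of_int[OF p(1), of "2 * (a \<bullet> b)" 2] by simp
qed

text \<open>The vector \<open>z0 + 2 a\<close> has odd inner products with all of \<open>Z\<close>, which forces its norm to be a
  2-adic unit.\<close>

lemma norm_p2: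
  assumes m: "even m" "\<not> 64 dvd m * (m + 1)"
    and a: "\<And>z. z \<in> Z \<Longrightarrow> z \<bullet> a \<in> p_integral 2"
  shows "2 * (a \<bullet> a) \<in> p_integral 2"
proof -
  obtain z0 where z0: "z0 \<in> Z" using Z_nonempty by blast
  obtain s :: int where s: "odd s" "\<And>z. z \<in> Z \<Longrightarrow> of_int s * (z \<bullet> a) \<in> \<int>"
    using p_integral_common_denominator[OF two_is_prime_nat finite_Z, of "\<lambda>z. z \<bullet> a"] a by auto
  define b where "b = of_int s *\<^sub>R (z0 + 2 *\<^sub>R a)"
  have b: "\<exists>k :: int. odd k \<and> z \<bullet> b = of_int k" if z: "z \<in> Z" for z
  proof -
    obtain k :: int where k: "odd k" "z \<bullet> z0 = of_int k" using inner_odd[OF z z0] .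
    obtain l :: int where l: "of_int s * (z \<bullet> a) = of_int l" using s(2)[OF z] by (metis Ints_cases)
    have "z \<bullet> b = of_int (s * k + 2 * l)"
      using k(2) l by (simp add: b_def inner_add_right algebra_simps)
    moreover have "odd (s * k + 2 * l)" using s(1) k(1) by simp
    ultimately show ?thesis by blast
  qed
  then have "z \<bullet> b \<in> \<int>" if "z \<in> Z" for z using that by (metis Ints_of_int)
  then obtain x y :: int where xy: "y > 0" "coprime x y" "b \<bullet> b = of_int x / of_int y"
    using norm_rational by metis
  define M d where "M = int (m * (m + 1))" and "d = 2 * int m + 1"
  have d: "odd d" by (simp add: d_def)
  have M64: "\<not> 64 dvd M"
  proof
    assume "64 dvd M"
    then have "int 64 dvd int (m * (m + 1))" by (simp add: M_def)
    with m(2) show False by (simp only: int_dvd_int_iff)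
  qed
  obtain k :: int where "real_of_int M * (3 * (b \<bullet> b)\<^sup>2 - 10 * of_int d * (b \<bullet> b) + 9 * (of_int d)\<^sup>2 - 18) = of_int (192 * k)"
    using norm_odd_condition[OF b] by (auto simp: M_def d_def)
  then have "real_of_int (M * (3 * x\<^sup>2 - 10 * d * x * y + (9 * d\<^sup>2 - 18) * y\<^sup>2)) = of_int (192 * k * y\<^sup>2)"
    using xy(1) unfolding xy(3) by (simp add: field_simps power2_eq_square)
  then have k: "M * (3 * x\<^sup>2 - 10 * d * x * y + (9 * d\<^sup>2 - 18) * y\<^sup>2) = 192 * k * y\<^sup>2"
    by (simp only: of_int_eq_iff)
  \<comment> \<open>If this factor were odd, the 64 in 192 would divide \<open>M\<close>. Modulo 2
    it is \<open>x + y\<close>, so the coprime \<open>x\<close> and \<open>y\<close> are both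
    odd.\<close>
  have "even (3 * x\<^sup>2 - 10 * d * x * y + (9 * d\<^sup>2 - 18) * y\<^sup>2)"
  proof (rule ccontr)
    assume "odd (3 * x\<^sup>2 - 10 * d * x * y + (9 * d\<^sup>2 - 18) * y\<^sup>2)"
    then have "coprime (2 ^ 6) (3 * x\<^sup>2 - 10 * d * x * y + (9 * d\<^sup>2 - 18) * y\<^sup>2)"
      by (simp add: coprime_left_2_iff_odd del: power_numeral)
    moreover have "2 ^ 6 dvd M * (3 * x\<^sup>2 - 10 * d * x * y + (9 * d\<^sup>2 - 18) * y\<^sup>2)"
      unfolding k by (intro dvd_mult2) simp
    ultimately have "2 ^ 6 dvd M" by (simp only: coprime_dvd_mult_left_iff)
    with M64 show False by simp
  qed
  then have "even x \<longleftrightarrow> even y" using d by auto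
  moreover have "\<not> (even x \<and> even y)" using xy(2) coprime_common_divisor_int[of x y 2] by auto
  ultimately have odd: "odd x" "odd y" by auto
  have s0: "s \<noteq> 0" using s(1) by auto
  \<comment> \<open>\<open>x / y\<close> is the norm of \<open>s (z0 + 2 a)\<close>, in which
    \<open>a \<bullet> a\<close> has coefficient \<open>4 * s\<^sup>2\<close>. Subtracting the
    contribution of \<open>z0\<close> leaves an even number, so twice the norm of \<open>a\<close>
    becomes 2-integral.\<close>
  have "even (x - d * s\<^sup>2 * y)" using odd d s by simp
  then obtain c where c: "x - d * s\<^sup>2 * y = 2 * c" by blast
  have "of_int (x - d * s\<^sup>2 * y) = (2 * of_int c :: real)" by (simp add: c)
  then have xc: "of_int x = (2 * of_int c + of_int d * (of_int s)\<^sup>2 * of_int y :: real)" by simp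
  have z00: "z0 \<bullet> z0 = of_int d" using inner_self[OF z0] by (simp add: d_def)
  have "b \<bullet> b = (of_int s)\<^sup>2 * (of_int d + 4 * (z0 \<bullet> a) + 4 * (a \<bullet> a))"
    by (simp add: b_def inner_add_left inner_add_right inner_commute[of a z0] z00
        power2_eq_square algebra_simps)
  then have "2 * (a \<bullet> a) = of_int c / of_int (s\<^sup>2 * y) - 2 * (z0 \<bullet> a)"
    using xy(1) s0 unfolding xy(3) xc by (simp add: field_simps)
  moreover have "of_int c / of_int (s\<^sup>2 * y) \<in> p_integral 2"
    by (rule p_integralI[of 2 "s\<^sup>2 * y" _ c]) (use s odd in auto)
  ultimately show ?thesis
    using a[OF z0] by (auto intro!: p2_intros)
qed

text \<open>Polarization costs another factor 2. So four times a Gram matrix of dual vectors is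
  2-integral, and by \<open>norm_p2\<close> its diagonal is even.\<close>

lemma inner_p2:
  assumes m: "even m" "\<not> 64 dvd m * (m + 1)"
    and a: "\<And>z. z \<in> Z \<Longrightarrow> z \<bullet> a \<in> p_integral 2" and b: "\<And>z. z \<in> Z \<Longrightarrow> z \<bullet> b \<in> p_integral 2"
  shows "4 * (a \<bullet> b) \<in> p_integral 2"
proof -
  note norm = norm_p2[OF m]
  have "2 * ((a + b) \<bullet> (a + b)) - 2 * (a \<bullet> a) - 2 * (b \<bullet> b) \<in> p_integral 2"
    by (intro p_integral_diff[OF two_is_prime_nat] norm) (auto simp: inner_add_right intro: a b p2_intros)
  then show ?thesis
    by (simp add: inner_add_left inner_add_right inner_commute[of b a])
qed

section \<open>Bases and their Gram determinants\<close>

text \<open>By \<open>moment_2\<close> a vector orthogonal to all of \<open>Z\<close> has norm zero,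
  so \<open>Z\<close> spans the space.\<close>

lemma exists_basis: "\<exists>P :: real ^ 'n ^ 'n. (\<forall>i. P $ i \<in> Z) \<and> det P \<noteq> 0"
proof -
  have dim: "dim Z = CARD('n)"
  proof (rule ccontr)
    assume "dim Z \<noteq> CARD('n)"
    then have "dim Z < DIM(real ^ 'n)"
      using dim_subset_UNIV[of Z] by simp
    then obtain x where x: "x \<noteq> 0" "\<And>y. y \<in> span Z \<Longrightarrow> orthogonal x y"
      by (rule orthogonal_to_subspace_exists) blast
    have "z \<bullet> x = 0" if "z \<in> Z" for z
      using x(2)[OF span_base[OF that]] by (simp add: orthogonal_def inner_commute)
    then have "(\<Sum>z\<in>Z. (z \<bullet> x)\<^sup>2) = 0" by simp
    moreover have "0 < 4 * real (m * (m + 1)) * (2 * real m + 1) * (x \<bullet> x)"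
      using x(1) by (intro mult_pos_pos[OF moment_2_factor_pos]) simp
    ultimately show False using moment_2[of x] by linarith
  qed
  obtain B where B: "B \<subseteq> Z" "independent B" "Z \<subseteq> span B" "card B = CARD('n)"
    using basis_exists[of Z] dim by metis
  then have "finite B" using independent_imp_finite by blast
  with B(4) obtain f :: "'n \<Rightarrow> real ^ 'n" where f: "bij_betw f UNIV B"
    using finite_same_card_bij[of "UNIV :: 'n set" B] by auto
  define P :: "real ^ 'n ^ 'n" where "P = (\<chi> i. f i)"
  have "rows P = B"
    using f by (auto simp: P_def rows_def row_def bij_betw_def vec_lambda_eta)
  moreover have "span B = UNIV"
    using B dim dim_eq_full[of B] dim_eq_card_independent[OF B(2)] by simp
  ultimately have "det P \<noteq> 0"
    using matrix_left_invertible_span_rows[of P] invertible_left_inverse[of P] invertible_det_nz[of P]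
    by simp
  moreover have "P $ i \<in> Z" for i
    using f B(1) by (auto simp: P_def bij_betw_def)
  ultimately show ?thesis by blast
qed

text \<open>A single determinant may be irrational, but the product of two is the determinant of an
  integral matrix of inner products. Taking \<open>P\<close> twice gives the Gram
  determinant.\<close>

lemma det_mult_Ints:
  assumes "\<And>i. P $ i \<in> Z" "\<And>i. R $ i \<in> Z"
  shows "det P * det R \<in> \<int>"
proof -
  have "det P * det R = det (P ** transpose R)" by (simp add: det_mul)
  also have "\<dots> \<in> \<int>"
    using assms by (intro Ints_det) (simp add: matrix_mult_transpose_nth inner_Ints)
  finally show ?thesis .
qed

end

lemma multiplicity_int_int: "multiplicity (int p) (int x) = multiplicity p x"
proof -
  have "int p ^ k dvd int x \<longleftrightarrow> p ^ k dvd x" for k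
    using int_dvd_int_iff[of "p ^ k" x] by simp
  then show ?thesis by (simp add: multiplicity_def)
qed

text \<open>Otherwise every prime power in the factorization, and so \<open>v\<close> itself, would
  be 1 modulo 4.\<close>

lemma three_mod_4_prime_factor:
  fixes v :: nat
  assumes "v mod 4 = 3"
  obtains p where "prime p" "p mod 4 = 3" "odd (multiplicity p v)"
proof -
  have "\<exists>p. prime p \<and> p mod 4 = 3 \<and> odd (multiplicity p v)"
  proof (rule ccontr)
    assume neg: "\<not> ?thesis"
    have "p ^ multiplicity p v mod 4 = 1" if "p \<in> prime_factors v" for p
    proof -
      have p: "prime p" "p dvd v" using that by auto
      have "odd v" using assms by presburger
      then have "odd p" using p(2) dvd_trans by blast
      then have "p mod 4 = 1 \<or> p mod 4 = 3" by presburger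
      then consider "p mod 4 = 1" | "p mod 4 = 3" "even (multiplicity p v)"
        using neg p(1) by blast
      then show ?thesis
      proof cases
        case 1
        have "p ^ multiplicity p v mod 4 = (p mod 4) ^ multiplicity p v mod 4" by (simp add: power_mod)
        then show ?thesis using 1 by simp
      next
        case 2
        then obtain l where l: "multiplicity p v = 2 * l" by blast
        have "p\<^sup>2 mod 4 = (p mod 4)\<^sup>2 mod 4" by (simp add: power_mod)
        then have p2: "p\<^sup>2 mod 4 = 1" using 2 by simp
        have "p ^ multiplicity p v mod 4 = (p\<^sup>2 mod 4) ^ l mod 4" by (simp add: l power_mult power_mod)
        then show ?thesis using p2 by simp
      qed
    qed
    then have "(\<Prod>p\<in>prime_factors v. p ^ multiplicity p v mod 4) mod 4 = 1"
      by simp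
    then have "(\<Prod>p\<in>prime_factors v. p ^ multiplicity p v) mod 4 = 1"
      by (simp only: mod_prod_eq)
    moreover have "v = (\<Prod>p\<in>prime_factors v. p ^ multiplicity p v)"
      using assms by (intro prime_factorization_nat) auto
    ultimately show False using assms by simp
  qed
  then show ?thesis using that by blast
qed

lemma matrix_inv_mult:
  fixes P :: "real ^ 'n ^ 'n::finite"
  assumes "det P \<noteq> 0"
  shows "P ** matrix_inv P = mat 1" "matrix_inv P ** P = mat 1"
proof -
  have "invertible P" using assms by (simp add: invertible_det_nz)
  then have "\<exists>Q. P ** Q = mat 1 \<and> Q ** P = mat 1" by (simp add: invertible_def)
  then have "P ** matrix_inv P = mat 1 \<and> matrix_inv P ** P = mat 1"
    unfolding matrix_inv_def by (rule someI_ex)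
  then show "P ** matrix_inv P = mat 1" "matrix_inv P ** P = mat 1" by auto
qed

text \<open>The basis dual to the rows of \<open>P\<close>; meaningless if \<open>P\<close> is singular.\<close>

definition dual_basis :: "real ^ 'n ^ 'n::finite \<Rightarrow> 'n \<Rightarrow> real ^ 'n" where
  "dual_basis P j = transpose (matrix_inv P) $ j"

lemma inner_dual_basis:
  assumes "det P \<noteq> 0"
  shows "P $ i \<bullet> dual_basis P j = (if i = j then 1 else 0)"
  using matrix_mult_transpose_nth[of P "transpose (matrix_inv P)" i j] matrix_inv_mult(1)[OF assms]
  by (simp add: dual_basis_def mat_def)

lemma dual_basis_expansion:
  fixes z :: "real ^ 'n::finite"
  assumes "det P \<noteq> 0"
  shows "(\<Sum>i\<in>UNIV. (z \<bullet> dual_basis P i) *s P $ i) = z"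
proof -
  have "(\<Sum>i\<in>UNIV. (z \<bullet> dual_basis P i) *s P $ i) = (z v* matrix_inv P) v* P"
    by (simp add: vec_eq_iff vector_matrix_mult_def dual_basis_def inner_vec_def transpose_def mult_ac)
  also have "\<dots> = z"
    by (simp add: vector_matrix_mul_assoc matrix_inv_mult(2)[OF assms])
  finally show ?thesis .
qed

lemma det_replace_row:
  fixes P :: "real ^ 'n ^ 'n::finite"
  assumes "det P \<noteq> 0"
  shows "det (\<chi> i. if i = k then z else P $ i) = (z \<bullet> dual_basis P k) * det P"
proof -
  have row: "row i P = P $ i" for i by (simp add: row_def vec_lambda_eta)
  show ?thesis
    using cramer_lemma_transpose[where k = k and A = P and x = "\<chi> i. z \<bullet> dual_basis P i"]
    by (simp only: row vec_lambda_beta dual_basis_expansion[OF assms])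
qed

lemma gram_dual_basis:
  fixes P :: "real ^ 'n ^ 'n::finite"
  assumes "det P \<noteq> 0"
  shows "(P ** transpose P) ** (\<chi> i j. dual_basis P i \<bullet> dual_basis P j) = mat 1"
proof -
  let ?Q = "matrix_inv P"
  have "(\<chi> i j. dual_basis P i \<bullet> dual_basis P j) = transpose ?Q ** ?Q"
    using matrix_mult_transpose_nth[of "transpose ?Q" "transpose ?Q"]
    by (simp add: vec_eq_iff dual_basis_def)
  moreover have "transpose P ** transpose ?Q = mat 1"
    using matrix_inv_mult(2)[OF assms] by (simp flip: matrix_transpose_mul)
  ultimately show ?thesis
    using matrix_inv_mult(1)[OF assms] by (metis matrix_mul_assoc matrix_mul_rid)
qed

context scaled_tight_design
begin

text \<open>A basis taken from \<open>Z\<close> whose Gram determinant has minimal valuation at \<open>p\<close> generates, over the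
  \<open>p\<close>-integral numbers, the same module as \<open>Z\<close>, by Cramer's rule.\<close>

lemma exists_local_basis:
  assumes p: "prime p"
  obtains P :: "real ^ 'n ^ 'n" where "\<And>i. P $ i \<in> Z" "det P \<noteq> 0"
    "\<And>z j. z \<in> Z \<Longrightarrow> z \<bullet> dual_basis P j \<in> p_integral p"
proof -
  \<comment> \<open>The floor only changes the type: the squared determinant is already an integer
    when all rows lie in \<open>Z\<close>.\<close>
  define \<nu> where "\<nu> P = multiplicity (int p) \<lfloor>(det P)\<^sup>2\<rfloor>" for P :: "real ^ 'n ^ 'n"
  obtain P where P: "\<And>i. P $ i \<in> Z" "det P \<noteq> 0"
    and min: "\<And>R. (\<forall>i. R $ i \<in> Z) \<and> det R \<noteq> 0 \<Longrightarrow> \<nu> P \<le> \<nu> R"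
    using ex_has_least_nat[of "\<lambda>P :: real ^ 'n ^ 'n. (\<forall>i. P $ i \<in> Z) \<and> det P \<noteq> 0" _ \<nu>] exists_basis
    by blast
  have pp: "prime_elem (int p)" using p by simp
  have "z \<bullet> dual_basis P j \<in> p_integral p" if z: "z \<in> Z" for z j
  proof (cases "z \<bullet> dual_basis P j = 0")
    case True
    then show ?thesis by (simp add: p_integral_0[OF p])
  next
    case False
    define c where "c = z \<bullet> dual_basis P j"
    define R where "R = (\<chi> i. if i = j then z else P $ i)"
    have detR: "det R = c * det P" by (simp add: R_def c_def det_replace_row[OF P(2)])
    have R: "R $ i \<in> Z" for i using P(1) z by (simp add: R_def)
    obtain g g' h :: int where gh: "(det P)\<^sup>2 = of_int g" "(det R)\<^sup>2 = of_int g'" "det R * det P = of_int h"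
      using det_mult_Ints[OF P(1) P(1)] det_mult_Ints[OF R R] det_mult_Ints[OF R P(1)]
      by (auto simp: power2_eq_square elim!: Ints_cases)
    have R0: "det R \<noteq> 0" using detR False P(2) by (simp add: c_def)
    have nz: "g \<noteq> 0" "g' \<noteq> 0" "h \<noteq> 0" using gh R0 P(2) by auto
    \<comment> \<open>The coordinate \<open>c\<close> is \<open>h / g\<close>. From
      \<open>h\<^sup>2 = g * g'\<close> and minimality of the valuation of \<open>g\<close>, the
      valuation of \<open>h\<close> is at least that of \<open>g\<close>.\<close>
    have "real_of_int (h\<^sup>2) = of_int (g * g')"
      using gh by (simp add: power_mult_distrib flip: gh)
    then have "h\<^sup>2 = g * g'" by (simp only: of_int_eq_iff)
    then have "2 * multiplicity (int p) h = multiplicity (int p) g + multiplicity (int p) g'"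
      using prime_elem_multiplicity_power_distrib[OF pp nz(3), of 2]
        prime_elem_multiplicity_mult_distrib[OF pp nz(1,2)] by simp
    moreover have "multiplicity (int p) g \<le> multiplicity (int p) g'"
      using min[of R] R R0 gh by (simp add: \<nu>_def)
    ultimately have le: "multiplicity (int p) g \<le> multiplicity (int p) h" by simp
    obtain g1 where g1: "g = int p ^ multiplicity (int p) g * g1" "\<not> int p dvd g1"
      using multiplicity_decompose'[OF nz(1)] pp by (metis prime_elem_def)
    have "int p ^ multiplicity (int p) g dvd h"
      using le by (rule multiplicity_dvd')
    then obtain h1 where h1: "h = int p ^ multiplicity (int p) g * h1" by blast
    have "c * of_int g = of_int h" using gh(1,3) detR by (metis mult.assoc power2_eq_square)
    then have "c = of_int h / of_int g" using nz by (simp add: field_simps)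
    also have "\<dots> = of_int h1 / of_int g1"
    proof -
      have "p \<noteq> 0" using p by auto
      then show ?thesis by (subst (1) g1(1), subst h1) simp
    qed
    finally show ?thesis using g1(2) unfolding c_def by (rule p_integralI[rotated])
  qed
  with P that show ?thesis by blast
qed

text \<open>For a basis \<open>P\<close> local at \<open>p\<close>, the dual Gram matrix is
  \<open>p\<close>-integral and inverse to the Gram matrix, so the Gram determinant
  \<open>g'\<close> is prime to \<open>p\<close>. For any basis \<open>R\<close> from
  \<open>Z\<close>, \<open>g * g'\<close> is a square, which settles the parity.\<close>

lemma even_multiplicity_gram:
  assumes p: "prime p" "(p = 3 \<and> [m = 1] (mod 3)) \<or> (p \<ge> 5 \<and> \<not> p\<^sup>2 dvd m * (m + 1))"
    and R: "\<And>i. R $ i \<in> Z" "det R \<noteq> 0" and g: "(det R)\<^sup>2 = of_int g"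
  shows "even (multiplicity (int p) g)"
proof -
  obtain P :: "real ^ 'n ^ 'n" where P: "\<And>i. P $ i \<in> Z" "det P \<noteq> 0"
    "\<And>z j. z \<in> Z \<Longrightarrow> z \<bullet> dual_basis P j \<in> p_integral p"
    using exists_local_basis[OF p(1)] by blast
  have pp: "prime_elem (int p)" using p(1) by simp
  define H where "H = (\<chi> i j. dual_basis P i \<bullet> dual_basis P j)"
  have "det H \<in> p_integral p"
    by (rule p_integral_det[OF p(1)]) (simp add: H_def inner_p_integral[OF p P(3) P(3)])
  moreover have "det (P ** transpose P) * det H = 1"
    using gram_dual_basis[OF P(2)] by (simp add: H_def flip: det_mul)
  then have "(det P)\<^sup>2 * det H = 1" by (simp add: det_mul power2_eq_square)
  moreover obtain g' h :: int where gh: "(det P)\<^sup>2 = of_int g'" "det R * det P = of_int h"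
    using det_mult_Ints[OF P(1) P(1)] det_mult_Ints[OF R(1) P(1)]
    by (auto simp: power2_eq_square elim!: Ints_cases)
  ultimately have "of_int g' * det H = 1" "det H \<in> p_integral p" by simp_all
  moreover have "\<not> int p dvd 1" using p(1) by (auto simp: prime_gt_1_nat)
  ultimately have "\<not> int p dvd g'"
  proof (intro notI)
    assume 1: "of_int g' * det H = 1" "det H \<in> p_integral p" "\<not> int p dvd 1" "int p dvd g'"
    then obtain q where q: "g' = int p * q" by blast
    have "of_int q * det H \<in> p_integral p"
      using 1(2) by (intro p_integral_mult[OF p(1)] p_integral_of_int[OF p(1)])
    moreover have "real p \<noteq> 0" using p(1) by auto
    then have "of_int q * det H = of_int 1 / p" using 1(1) by (simp add: q field_simps)
    ultimately have "int p dvd 1"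
      by (intro of_int_divide_p_integralD[OF p(1)]) simp
    with 1(3) show False by blast
  qed
  then have m0: "multiplicity (int p) g' = 0" by (rule not_dvd_imp_multiplicity_0)
  have nz: "g \<noteq> 0" "g' \<noteq> 0" "h \<noteq> 0" using g gh R(2) P(2) by auto
  have "real_of_int (h\<^sup>2) = of_int (g * g')"
    using g gh by (simp add: power_mult_distrib flip: g gh)
  then have "h\<^sup>2 = g * g'" by (simp only: of_int_eq_iff)
  then have "2 * multiplicity (int p) h = multiplicity (int p) g"
    using prime_elem_multiplicity_power_distrib[OF pp nz(3), of 2]
      prime_elem_multiplicity_mult_distrib[OF pp nz(1,2)] m0 by simp
  then show ?thesis by (metis even_mult_iff even_numeral)
qed

text \<open>One row of odd norm \<open>d\<close> is split off. Its Schur complement is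
  \<open>2 K\<close>, whose inverse is the dual Gram matrix restricted to the other indices; hence
  \<open>T = 2 K\<^sup>-\<^sup>1\<close> is 4 times that restriction.\<close>

lemma gram_det_2adic:
  assumes m: "even m" "\<not> 64 dvd m * (m + 1)" and n: "CARD('n) = (2 * m + 1)\<^sup>2 - 2"
    and P: "\<And>i. P $ i \<in> Z" "det P \<noteq> 0" "\<And>z j. z \<in> Z \<Longrightarrow> z \<bullet> dual_basis P j \<in> p_integral 2"
  shows "\<exists>k w. (det P)\<^sup>2 = 4 powi k * w \<and> cong4 w (-1)"
proof -
  obtain i0 :: 'n where True by blast
  define d where "d = 2 * real m + 1"
  define di where "di = 2 * int m + 1"
  have d: "d = of_int di" "odd di" "d > 0" by (auto simp: d_def di_def)
  define G where "G a b = P $ a \<bullet> P $ b" for a b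
  have symG: "G a b = G b a" for a b by (simp add: G_def inner_commute)
  have Gd: "G a a = d" for a using inner_self[OF P(1)] by (simp add: G_def d_def)
  have G1: "\<bar>G a i0\<bar> = 1" if "a \<noteq> i0" for a
  proof -
    have "P $ a \<bullet> dual_basis P a = 1" "P $ i0 \<bullet> dual_basis P a = 0"
      using that by (simp_all add: inner_dual_basis[OF P(2)])
    then have "P $ i0 \<noteq> P $ a" "P $ i0 \<noteq> - P $ a" by auto
    then show ?thesis unfolding G_def by (intro inner_distinct P(1))
  qed
  have Gint: "G a b / d \<in> p_integral 2" for a b
  proof -
    obtain k :: int where "G a b = of_int k" unfolding G_def by (rule inner_odd[OF P(1) P(1)])
    then show ?thesis using d by (auto intro: p_integralI[of 2 di _ k])
  qed
  define H where "H a b = dual_basis P a \<bullet> dual_basis P b" for a b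
  have GH: "(\<Sum>c\<in>UNIV. G a c * H c b) = (if a = b then 1 else 0)" for a b
  proof -
    have "((P ** transpose P) ** (\<chi> i j. dual_basis P i \<bullet> dual_basis P j)) $ a $ b = (if a = b then 1 else 0)"
      by (simp add: gram_dual_basis[OF P(2)] mat_def)
    then show ?thesis
      by (subst (asm) matrix_matrix_mult_def) (simp add: matrix_mult_transpose_nth G_def H_def)
  qed
  define K :: "real ^ 'n ^ 'n" where
    "K = (\<chi> a b. if a = i0 \<or> b = i0 then (if a = b then 1 else 0) else (G a b - G a i0 * G i0 b / d) / 2)"
  define T :: "real ^ 'n ^ 'n" where
    "T = (\<chi> a b. if a = i0 \<or> b = i0 then (if a = b then 1 else 0) else 4 * H a b)"
  have "even_pair (UNIV - {i0}) K T"
    unfolding even_pair_def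
  proof (intro conjI allI ballI impI)
    fix a b
    show "K $ a $ b = K $ b $ a"
      by (auto simp: K_def symG[of a b] symG[of i0] mult.commute)
    show "T $ a $ b = T $ b $ a"
      by (auto simp: T_def H_def inner_commute)
    show "K $ a $ b \<in> p_integral 2"
    proof (cases "a = i0 \<or> b = i0")
      case False
      obtain k1 k2 k3 :: int where k: "odd k1" "G a b = of_int k1" "odd k2" "G a i0 = of_int k2"
        "odd k3" "G i0 b = of_int k3"
        unfolding G_def by (metis inner_odd P(1))
      have "even (di * k1 - k2 * k3)" using k d by simp
      then obtain c where "di * k1 - k2 * k3 = 2 * c" by blast
      then have "real_of_int (di * k1 - k2 * k3) = of_int (2 * c)" by simp
      then have "(G a b - G a i0 * G i0 b / d) / 2 = of_int c / of_int di"
        using d by (simp add: k field_simps)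
      then show ?thesis using False d(2) by (auto simp: K_def intro: p_integralI)
    qed (auto simp: K_def p2_intros)
    show "T $ a $ b \<in> p_integral 2"
      using inner_p2[OF m P(3) P(3)] by (auto simp: T_def H_def p2_intros)
  next
    fix a assume "a \<in> UNIV - {i0}"
    then have a: "a \<noteq> i0" by simp
    have "G a i0 * G i0 a = 1"
      using G1[OF a] symG[of i0 a] by (metis abs_mult_self_eq mult_1)
    \<comment> \<open>The diagonal of the Schur complement is
      \<open>d - 1 / d = 4 * m * (m + 1) / d\<close>, so half the diagonal entry of \<open>K\<close>
      is 2-integral.\<close>
    then have "K $ a $ a / 2 = (d - 1 / d) / 4"
      using a by (simp add: K_def Gd)
    also have "\<dots> = (d\<^sup>2 - 1) / 4 / d" using d by (simp add: field_simps power2_eq_square)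
    also have "(d\<^sup>2 - 1) / 4 = of_int (int (m * (m + 1)))"
      by (simp add: d_def power2_eq_square algebra_simps)
    finally show "K $ a $ a / 2 \<in> p_integral 2"
      unfolding d(1) by (rule p_integralI[rotated]) (use d(2) in simp)
    show "T $ a $ a / 2 \<in> p_integral 2"
      using a norm_p2[OF m P(3)] by (simp add: T_def H_def)
  next
    fix a b assume "a \<notin> UNIV - {i0}"
    then show "K $ a $ b = (if a = b then 1 else 0)" "T $ a $ b = (if a = b then 1 else 0)"
      by (auto simp: K_def T_def)
  next
    have "(K ** T) $ a $ b = (if a = b then if a \<in> UNIV - {i0} then 2 else 1 else 0)" for a b
    proof (cases "a = i0 \<or> b = i0")
      case True
      have "K $ a $ c * T $ c $ b = (if c = i0 then if a = b then 1 else 0 else 0)" for c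
        using True by (auto simp: K_def T_def)
      then show ?thesis using True by (auto simp: matrix_matrix_mult_def)
    next
      case False
      \<comment> \<open>At \<open>c = i0\<close> the right-hand side cancels since
        \<open>G i0 i0 = d\<close>, so the sum over all indices reduces to
        \<open>GH\<close>.\<close>
      have "K $ a $ c * T $ c $ b = 2 * (G a c * H c b) - 2 * (G a i0 / d) * (G i0 c * H c b)" for c
        using False d(3) by (cases "c = i0") (auto simp: K_def T_def Gd field_simps)
      then have "(K ** T) $ a $ b =
          2 * (\<Sum>c\<in>UNIV. G a c * H c b) - 2 * (G a i0 / d) * (\<Sum>c\<in>UNIV. G i0 c * H c b)"
        by (simp add: matrix_matrix_mult_def sum_subtractf sum_distrib_left)
      then show ?thesis using False unfolding GH by auto
    qed
    then show "K ** T = (\<chi> a b. if a = b then if a \<in> UNIV - {i0} then 2 else 1 else 0)"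
      by (simp add: vec_eq_iff)
  qed
  from even_pair_det[OF this] obtain k w where
    kw: "det K = 4 powi k * w" "cong4 w ((-1) ^ (card (UNIV - {i0}) div 2))" by blast
  \<comment> \<open>Half the rank \<open>n - 1 = d\<^sup>2 - 3\<close>; it is odd, which fixes the
    sign to -1. The truncated subtraction is exact because \<open>m > 0\<close>.\<close>
  define h where "h = 2 * m\<^sup>2 + 2 * m - 1"
  have "m\<^sup>2 > 0" using m_pos by simp
  then have h: "CARD('n) - 1 = 2 * h" "odd h"
    using m_pos unfolding n h_def by (auto simp: power2_eq_square algebra_simps)
  then have w: "cong4 w (of_int (-1))"
    using kw(2) by (simp add: card_Diff_singleton)
  define N :: "real ^ 'n ^ 'n" where "N = (\<chi> a b. if b = i0 \<and> a \<noteq> i0 then - (G a i0 / d) else 0)"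
  have N_row: "(\<Sum>c\<in>UNIV. N $ a $ c * f c) = N $ a $ i0 * f i0" for a f
  proof -
    have "(\<Sum>c\<in>UNIV. N $ a $ c * f c) = (\<Sum>c\<in>UNIV. if c = i0 then N $ a $ i0 * f i0 else 0)"
      by (rule sum.cong) (auto simp: N_def)
    then show ?thesis by simp
  qed
  have N_int: "N $ a $ b \<in> p_integral 2" for a b
    using Gint by (auto simp: N_def intro: p2_intros)
  have NN: "N ** N = 0"
    by (simp add: vec_eq_iff matrix_matrix_mult_def N_row) (simp add: N_def)
  define L where "L a b = G a b + N $ a $ i0 * G i0 b" for a b
  have mulE: "((mat 1 + N) ** (P ** transpose P)) $ a $ b = L a b" for a b
  proof -
    have "((mat 1 + N) ** (P ** transpose P)) $ a $ b = (\<Sum>c\<in>UNIV. (if a = c then G c b else 0) + N $ a $ c * G c b)"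
      by (subst matrix_matrix_mult_def)
        (simp add: mat_def matrix_mult_transpose_nth G_def, rule sum.cong, auto simp: G_def algebra_simps)
    then show ?thesis
      by (simp add: sum.distrib N_row L_def)
  qed
  define B where "B = (mat 1 + N) ** (P ** transpose P) ** transpose (mat 1 + N)"
  have B: "B $ a $ b = L a b + N $ b $ i0 * L a i0" for a b
  proof -
    have "B $ a $ b = (\<Sum>c\<in>UNIV. (if b = c then L a c else 0) + N $ b $ c * L a c)"
      unfolding B_def matrix_matrix_mult_def[of "(mat 1 + N) ** (P ** transpose P)"] vec_lambda_beta mulE
      by (rule sum.cong) (auto simp: transpose_def mat_def algebra_simps)
    then show ?thesis by (simp add: sum.distrib N_row)
  qed
  \<comment> \<open>Eliminating row \<open>i0\<close> leaves \<open>d\<close> at \<open>i0\<close>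
    and \<open>2 K\<close> elsewhere; \<open>D1\<close> carries \<open>d\<close> and the factors 2,
    an even number of them.\<close>
  define D1 :: "real ^ 'n ^ 'n" where "D1 = (\<chi> a b. if a = b then if a = i0 then d else 2 else 0)"
  have "B $ a $ b = (D1 ** K) $ a $ b" for a b
  proof -
    have "D1 $ a $ c * K $ c $ b = (if a = c then (if a = i0 then d else 2) * K $ a $ b else 0)" for c
      by (simp add: D1_def)
    then have "(D1 ** K) $ a $ b = (if a = i0 then d else 2) * K $ a $ b"
      by (simp add: matrix_matrix_mult_def)
    also have "\<dots> = B $ a $ b"
      using d(3) by (auto simp: B L_def N_def K_def Gd symG[of b i0])
    finally show ?thesis ..
  qed
  then have "B = D1 ** K" by (simp add: vec_eq_iff)
  moreover have "det D1 = d * 2 ^ (CARD('n) - 1)"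
  proof -
    have "det D1 = (\<Prod>i\<in>UNIV. D1 $ i $ i)" by (rule det_diagonal) (simp add: D1_def)
    also have "\<dots> = D1 $ i0 $ i0 * (\<Prod>i\<in>UNIV - {i0}. D1 $ i $ i)" by (rule prod.remove) auto
    also have "(\<Prod>i\<in>UNIV - {i0}. D1 $ i $ i) = (\<Prod>i\<in>UNIV - {i0}. 2)"
      by (rule prod.cong) (auto simp: D1_def)
    finally show ?thesis by (simp add: D1_def card_Diff_singleton)
  qed
  moreover have "det B = (det (mat 1 + N))\<^sup>2 * (det P)\<^sup>2"
    by (simp add: B_def det_mul power2_eq_square)
  ultimately have det: "(det (mat 1 + N))\<^sup>2 * (det P)\<^sup>2 = d * 4 ^ h * (4 powi k * w)"
    unfolding kw(1)[symmetric] h by (simp add: det_mul power_mult)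
  define e where "e = (det (mat 1 + N))\<^sup>2"
  have e: "e \<noteq> 0" "cong4 e (of_int 1)"
    using det_unipotent[OF N_int NN] by (auto simp: e_def)
  \<comment> \<open>Evenness of \<open>m\<close> gives \<open>d\<close> the residue 1, so splitting
    off the row does not disturb the sign.\<close>
  have "cong4 d (of_int 1)"
  proof -
    obtain l where "m = 2 * l" using m(1) by blast
    then have "(d - of_int 1) / 4 = of_int (int l)" by (simp add: d_def)
    then show ?thesis by (simp only: p_integral_of_int[OF two_is_prime_nat])
  qed
  from cong4_mult[OF cong4_mult[OF this w] cong4_inverse[OF e(2)]]
  have "cong4 (d * w * (1 / e)) (-1)" by simp
  moreover have "(det P)\<^sup>2 = 4 powi (int h + k) * (d * w * (1 / e))"
  proof -
    have "e * (det P)\<^sup>2 = d * 4 ^ h * (4 powi k * w)" using det by (simp only: e_def)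
    then show ?thesis using e(1) by (simp add: power_int_add field_simps)
  qed
  ultimately show ?thesis by blast
qed

section \<open>The local determinants contradict each other\<close>

lemma no_scaled_tight_design:
  assumes m: "even m" "\<not> 64 dvd m * (m + 1)" "[m = 1] (mod 3)"
    and n: "CARD('n) = (2 * m + 1)\<^sup>2 - 2"
    and mult: "\<And>p. prime p \<Longrightarrow> p \<ge> 7 \<Longrightarrow> [p = 3] (mod 4) \<Longrightarrow> \<not> p\<^sup>2 dvd m * (m + 1)"
  shows False
proof -
  obtain P where P: "\<And>i. P $ i \<in> Z" "det P \<noteq> 0" "\<And>z j. z \<in> Z \<Longrightarrow> z \<bullet> dual_basis P j \<in> p_integral 2"
    using exists_local_basis[OF two_is_prime_nat] by blast
  obtain k w where kw: "(det P)\<^sup>2 = 4 powi k * w" "cong4 w (of_int (-1))"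
    using gram_det_2adic[OF m(1,2) n P] by auto
  obtain g :: int where g: "(det P)\<^sup>2 = of_int g"
    using det_mult_Ints[OF P(1) P(1)] by (auto simp: power2_eq_square elim!: Ints_cases)
  have g0: "g > 0" using g P(2) by (metis of_int_0_less_iff zero_less_power2)
  obtain x y :: int where xy: "odd x" "odd y" "w = of_int x / of_int y"
    using cong4_unit[OF kw(2)] by (auto elim: p2_unitE)
  have y0: "y \<noteq> 0" using xy by auto
  \<comment> \<open>A negative \<open>k\<close> would make the odd \<open>x\<close> a multiple of 4,
    because \<open>g\<close> is an integer.\<close>
  have "k \<ge> 0"
  proof (rule ccontr)
    assume "\<not> k \<ge> 0"
    then obtain l where l: "k = - int (Suc l)" by (metis int_cases of_nat_0_le_iff)
    have "4 powi k = (1 / 4 ^ Suc l :: real)"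
      unfolding l by (simp add: power_int_minus divide_inverse del: of_nat_Suc power_Suc)
    then have "real_of_int g = 1 / 4 ^ Suc l * (of_int x / of_int y)"
      using kw(1) unfolding g xy(3) by (simp only:)
    then have "real_of_int (g * y * 4 ^ Suc l) = of_int x"
      using y0 by (simp add: field_simps)
    then have "g * y * 4 ^ Suc l = x" by (simp only: of_int_eq_iff)
    with xy(1) show False by auto
  qed
  then obtain l where l: "k = int l" by (metis nonneg_int_cases)
  have "real_of_int (g * y) = of_int (4 ^ l * x)"
    using kw(1) y0 unfolding g xy(3) l by (simp add: field_simps)
  then have gy: "g * y = 4 ^ l * x" by (simp only: of_int_eq_iff)
  then have "4 ^ l dvd g * y" by simp
  moreover have "coprime (2 ^ (2 * l)) y" using xy(2) by simp
  then have "coprime (4 ^ l) y" by (simp add: power_mult)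
  ultimately have "4 ^ l dvd g" by (simp only: coprime_dvd_mult_left_iff)
  then obtain v where v: "g = 4 ^ l * v" by blast
  have "v > 0" using g0 v by (simp add: zero_less_mult_iff)
  have "w = of_int v"
    using gy y0 unfolding v xy(3) by (simp add: field_simps flip: of_int_mult)
  then have "of_int (v + 1) / 4 \<in> p_integral 2" using kw(2) by simp
  then obtain c b :: int where b: "odd b" "b \<noteq> 0" "of_int (v + 1) / 4 = (of_int c / of_int b :: real)"
    by (auto elim: p_integralE)
  then have "real_of_int ((v + 1) * b) = of_int (4 * c)" by (simp add: field_simps)
  then have "(v + 1) * b = 4 * c" by (simp only: of_int_eq_iff)
  then have "2 ^ 2 dvd (v + 1) * b" by simp
  moreover have "coprime (2 ^ 2) b" using b(1) by (subst coprime_power_left_iff) simp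
  ultimately have "2 ^ 2 dvd v + 1" by (simp only: coprime_dvd_mult_left_iff)
  then have "4 dvd v + 1" by simp
  then have "v mod 4 = 3" by presburger
  moreover have "nat v mod 4 = nat (v mod 4)" using \<open>v > 0\<close> by (simp add: nat_mod_distrib)
  ultimately have "nat v mod 4 = 3" by simp
  then obtain p where p: "prime p" "p mod 4 = 3" "odd (multiplicity p (nat v))"
    by (rule three_mod_4_prime_factor)
  \<comment> \<open>The only prime below 7 that is 3 modulo 4 is 3, which the congruence on
    \<open>m\<close> handles.\<close>
  have "(p = 3 \<and> [m = 1] (mod 3)) \<or> (p \<ge> 5 \<and> \<not> p\<^sup>2 dvd m * (m + 1))"
  proof (cases "p \<ge> 7")
    case True
    then show ?thesis using mult[OF p(1) True] p(2) by (simp add: cong_def)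
  next
    case False
    then have "p = 3" using p(2) by presburger
    then show ?thesis using m(3) by simp
  qed
  from even_multiplicity_gram[OF p(1) this P(1,2) g] have "even (multiplicity (int p) g)" .
  moreover have "multiplicity (int p) g = multiplicity (int p) v"
  proof -
    have pp: "prime_elem (int p)" using p(1) by simp
    have "\<not> int p dvd 2"
      using p(1,2) prime_gt_1_nat[OF p(1)] by (auto dest!: zdvd_imp_le simp: le_Suc_eq numeral_2_eq_2)
    then have "\<not> int p dvd 2 * 2"
      using p(1) by (subst prime_dvd_mult_iff) auto
    then have "\<not> int p dvd 4 ^ l"
      using p(1) prime_dvd_power[of "int p" 4 l] by auto
    then have "multiplicity (int p) (4 ^ l) = 0" by (rule not_dvd_imp_multiplicity_0)
    then show ?thesis
      using \<open>v > 0\<close> by (simp add: v prime_elem_multiplicity_mult_distrib[OF pp])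
  qed
  moreover have "multiplicity (int p) v = multiplicity p (nat v)"
    using \<open>v > 0\<close> multiplicity_int_int[of p "nat v"] by simp
  ultimately show False using p(3) by simp
qed

end

theorem theorem1p1:
  fixes m :: nat
  assumes "m > 0" and "even m" and "[m = 1] (mod 3)"
    and "multiplicity 2 (m * (m + 1)) \<le> 5"
    and "\<And>p::nat. prime p \<Longrightarrow> p \<ge> 7 \<Longrightarrow> [p = 3] (mod 4) \<Longrightarrow> multiplicity p (m * (m + 1)) \<le> 1"
    and "CARD('n::finite) = (2 * m + 1)\<^sup>2 - 2"
  shows "\<not> (\<exists>D :: (real ^ 'n) set. tight_spherical_5_design D)"
proof
  assume "\<exists>D :: (real ^ 'n) set. tight_spherical_5_design D"
  then obtain D :: "(real ^ 'n) set" where D: "tight_spherical_5_design D" by blast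
  define d where "d = 2 * real m + 1"
  have d: "d > 0" "sqrt d * sqrt d = d" by (auto simp: d_def)
  have "m\<^sup>2 > 0" using assms(1) by simp
  then have "2 \<le> (2 * m + 1)\<^sup>2" and n2: "CARD('n) \<ge> 2"
    unfolding assms(6) using assms(1) by (auto simp: power2_eq_square algebra_simps)
  then have nd: "real CARD('n) = d\<^sup>2 - 2"
    unfolding assms(6) by (simp add: of_nat_diff d_def)
  \<comment> \<open>These two identities are why \<open>d\<close> appears: the inner products of
    distinct non-antipodal points are \<open>1 / d\<close> up to sign, and \<open>n + 1\<close>
    supplies the factor \<open>m * (m + 1)\<close>.\<close>
  have n1: "real CARD('n) + 1 = 4 * real (m * (m + 1))" "real CARD('n) + 2 = d\<^sup>2"
    unfolding nd by (simp_all add: d_def power2_eq_square algebra_simps)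
  have n0: "real CARD('n) > 0" by simp
  have D5: "spherical_design 5 D" and card: "real (card D) = real CARD('n) * (real CARD('n) + 1)"
    using D by (auto simp: tight_spherical_5_design_def algebra_simps)
  \<comment> \<open>Scaling by the root of \<open>d\<close> multiplies inner products by
    \<open>d\<close>, so \<open>1 / d\<close> becomes 1 and the norm becomes
    \<open>d\<close>.\<close>
  define Z where "Z = (\<lambda>x. sqrt d *\<^sub>R x) ` D"
  have inj: "inj_on (\<lambda>x. sqrt d *\<^sub>R x) D" using d(1) by (auto simp: inj_on_def)
  have inner: "(sqrt d *\<^sub>R x) \<bullet> (sqrt d *\<^sub>R y) = d * (x \<bullet> y)" for x y :: "real ^ 'n"
    using d(2) by (metis inner_scaleR_left inner_scaleR_right mult.assoc)
  interpret scaled_tight_design Z m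
  proof
    show "m > 0" by fact
    show "finite Z" "Z \<noteq> {}" using D5 by (auto simp: Z_def spherical_design_def)
    show "z \<bullet> z = 2 * real m + 1" if "z \<in> Z" for z
    proof -
      obtain x where x: "x \<in> D" "z = sqrt d *\<^sub>R x" using \<open>z \<in> Z\<close> by (auto simp: Z_def)
      then have "norm x = 1" using D5 by (auto simp: spherical_design_def)
      then have "x \<bullet> x = 1" by (simp add: norm_eq_1)
      then show ?thesis unfolding x(2) inner by (simp add: d_def)
    qed
    show "\<bar>z \<bullet> w\<bar> = 1" if "z \<in> Z" "w \<in> Z" "w \<noteq> z" "w \<noteq> - z" for z w
    proof -
      obtain x y where xy: "x \<in> D" "y \<in> D" "z = sqrt d *\<^sub>R x" "w = sqrt d *\<^sub>R y"
        using \<open>z \<in> Z\<close> \<open>w \<in> Z\<close> unfolding Z_def by blast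
      then have "y \<noteq> x" "y \<noteq> - x" using that by auto
      then have "(x \<bullet> y)\<^sup>2 = 1 / (CARD('n) + 2)"
        using tight_spherical_5_design_inner(2)[OF D n2] xy by blast
      then have "(x \<bullet> y)\<^sup>2 = 1 / d\<^sup>2" using n1(2) by (simp add: add.commute)
      then have "(d * (x \<bullet> y))\<^sup>2 = 1" using d(1) by (simp add: power_mult_distrib)
      then show ?thesis unfolding xy(3,4) inner by (simp add: abs_square_eq_1)
    qed
    show "- z \<in> Z" if "z \<in> Z" for z
    proof -
      obtain x where x: "x \<in> D" "z = sqrt d *\<^sub>R x" using \<open>z \<in> Z\<close> by (auto simp: Z_def)
      then have "- x \<in> D" using tight_spherical_5_design_inner(1)[OF D n2] by blast
      then have "sqrt d *\<^sub>R (- x) \<in> Z" unfolding Z_def by (rule imageI)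
      then show ?thesis by (simp add: x)
    qed
    show "real (card Z) = 4 * real (m * (m + 1)) * ((2 * real m + 1)\<^sup>2 - 2)"
    proof -
      have "card Z = card D" unfolding Z_def by (rule card_image[OF inj])
      then have "real (card Z) = (d\<^sup>2 - 2) * (4 * real (m * (m + 1)))"
        using card n1(1) nd by metis
      then show ?thesis unfolding d_def by (simp only: mult.commute)
    qed
    fix a :: "real ^ 'n"
    have "(\<Sum>z\<in>Z. (z \<bullet> a)\<^sup>2) = d * (\<Sum>x\<in>D. (x \<bullet> a)\<^sup>2)"
      using d(1) by (simp add: Z_def sum.reindex[OF inj] power_mult_distrib sum_distrib_left)
    also have "\<dots> = d * ((real CARD('n) + 1) * (a \<bullet> a))"
      using n0 unfolding spherical_design_moment_2[OF D5 n2] card by simp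
    finally show "(\<Sum>z\<in>Z. (z \<bullet> a)\<^sup>2) = 4 * real (m * (m + 1)) * (2 * real m + 1) * (a \<bullet> a)"
      unfolding n1(1) d_def by (simp only: mult_ac)
    have s4: "sqrt d ^ 4 = d\<^sup>2"
      using d(1) power_mult[of "sqrt d" 2 2] by simp
    have "(\<Sum>z\<in>Z. (z \<bullet> a) ^ 4) = d\<^sup>2 * (\<Sum>x\<in>D. (x \<bullet> a) ^ 4)"
      by (simp add: Z_def sum.reindex[OF inj] power_mult_distrib sum_distrib_left s4)
    also have "real (CARD('n) * (CARD('n) + 2)) = real CARD('n) * d\<^sup>2"
      unfolding n1(2)[symmetric] by (simp add: algebra_simps)
    then have "d\<^sup>2 * (\<Sum>x\<in>D. (x \<bullet> a) ^ 4) = (real CARD('n) + 1) * (3 * (a \<bullet> a)\<^sup>2)"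
      using n0 d(1) unfolding spherical_design_moment_4[OF D5 n2] card by simp
    finally show "(\<Sum>z\<in>Z. (z \<bullet> a) ^ 4) = 12 * real (m * (m + 1)) * (a \<bullet> a)\<^sup>2"
      unfolding n1(1) by simp
  qed
  have "m * (m + 1) \<noteq> 0" using assms(1) by simp
  show False
  proof (rule no_scaled_tight_design[OF assms(2) _ assms(3) assms(6)])
    have "\<not> 2 ^ 6 dvd m * (m + 1)"
      using assms(4) \<open>m * (m + 1) \<noteq> 0\<close> by (subst power_dvd_iff_le_multiplicity) auto
    then show "\<not> 64 dvd m * (m + 1)" by simp
    show "\<not> p\<^sup>2 dvd m * (m + 1)" if "prime p" "p \<ge> 7" "[p = 3] (mod 4)" for p
      using assms(5)[OF that] that(2) \<open>m * (m + 1) \<noteq> 0\<close>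
      by (subst power_dvd_iff_le_multiplicity) auto
  qed
qed

end
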